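(* For any positive integers $k,d$ there exists a constant $m_0(k,d)$ such that for every $m\ge m_0(k,d)$, every primitive fusion $\mathfrak{X}$ of $\mathcal{J}(m,k)^d$ belongs, up to permuting coordinates, to one of the following intervals: (1) $\mathcal{J}(m,k)^d \le \mathfrak{X} \le \mathcal{C}(m,k,d)$; (2) $\mathcal{T}_{M^e}^{d/e} \le \mathfrak{X} \le \mathcal{H}(d/e, M^e)$ for some positive integer $e$ dividing $d$, where $M=\binom{m}{k}$. Here "up to permuting coordinates" in case (2) means: there is a partition of the coordinate set $\{1,\dots,d\}$ into $d/e$ blocks of size $e$ such that, identifying $\Omega^d$ with $(\Omega^e)^{d/e}$ via this partition, $\mathcal{T}_{M^e}^{d/e}\le\mathfrak{X}\le\mathcal{H}(d/e,M^e)$ with respect to this identification.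
   Context: All association schemes are symmetric; an association scheme on a finite set $V$ is regarded as a partition of $V\times V$ into relations (one of which is the diagonal). For schemes $\mathfrak{X},\mathfrak{Y}$ on the same vertex set, $\mathfrak{X}\le\mathfrak{Y}$ means $\mathfrak{X}$ refines $\mathfrak{Y}$ as a partition (every relation of $\mathfrak{Y}$ is a union of relations of $\mathfrak{X}$). A fusion of a scheme is a coarsening of it which is again an association scheme. A scheme is primitive if the graph of every non-diagonal relation is connected. Let $\Omega$ be the set of $k$-subsets of $\{1,\dots,m\}$ and $M=|\Omega|=\binom{m}{k}$. The Johnson scheme $\mathcal{J}(m,k)$ on $\Omega$ has relations $R_i=\{(u,v):|u\setminus v|=i\}$, $0\le i\le k$. Its $d$th tensor power $\mathcal{J}(m,k)^d$ has vertex set $\Omega^d$ and relations $R_a$, $a\in\{0,\dots,k\}^d$, where $(u,v)\in R_a$ iff $|u_i\setminus v_i|=a_i$ for all $i$. The Cameron scheme $\mathcal{C}(m,k,d)$ (symmetrized tensor power) on $\Omega^d$ has as relations the unions of the $R_a$ over orbits of the symmetric group $S_d$ permuting coordinates of $a$. For a set $A$ of size $N$ and $r\ge1$, the Hamming scheme $\mathcal{H}(r,N)$ on $A^r$ has relations indexed by $j\in\{0,\dots,r\}$: $(x,y)$ in relation $j$ iff $x,y$ differ in exactly $j$ coordinates; the trivial scheme $\mathcal{T}_N$ on $A$ has the two relations (diagonal and its complement), and $\mathcal{T}_N^r$ is its $r$th tensor power on $A^r$ (relations indexed by the set of coordinates where $x,y$ differ). In case (2), $A=\Omega^e$ and $N=M^e$.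 *)

theory Defs
  imports Main "HOL-Library.FuncSet" "HOL-Library.Disjoint_Sets" "HOL-Combinatorics.Permutations"
begin

definition assoc_scheme :: "'a set \<Rightarrow> ('a \<times> 'a) set set \<Rightarrow> bool" where
  "assoc_scheme V \<X> \<longleftrightarrow>
     finite V \<and> partition_on (V \<times> V) \<X> \<and> Id_on V \<in> \<X> \<and> (\<forall>R\<in>\<X>. sym R) \<and>
     (\<forall>R\<in>\<X>. \<forall>S\<in>\<X>. \<forall>T\<in>\<X>. \<exists>p::nat. \<forall>(x, y)\<in>T.
        card {z\<in>V. (x, z) \<in> R \<and> (z, y) \<in> S} = p)"

(* The order on schemes with vertex set V is refines (V \<times> V), from Disjoint_Sets. *)

definition fusion :: "'a set \<Rightarrow> ('a \<times> 'a) set set \<Rightarrow> ('a \<times> 'a) set set \<Rightarrow> bool" where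
  "fusion V \<S> \<X> \<longleftrightarrow> assoc_scheme V \<X> \<and> refines (V \<times> V) \<S> \<X>"

definition primitive :: "'a set \<Rightarrow> ('a \<times> 'a) set set \<Rightarrow> bool" where
  "primitive V \<X> \<longleftrightarrow> (\<forall>R\<in>\<X>. R \<noteq> Id_on V \<longrightarrow> (\<forall>x\<in>V. \<forall>y\<in>V. (x, y) \<in> R\<^sup>*))"

(* The power V^I is the extensional function space I \<rightarrow>\<^sub>E V.  A relation of a tensor power is
   indexed by a family a of relations of the factor (in place of a family of indices of them). *)

definition tensor_rel :: "'i set \<Rightarrow> 'a set \<Rightarrow> ('i \<Rightarrow> ('a \<times> 'a) set) \<Rightarrow> (('i \<Rightarrow> 'a) \<times> ('i \<Rightarrow> 'a)) set" where
  "tensor_rel I V a =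
     {(u, v). u \<in> I \<rightarrow>\<^sub>E V \<and> v \<in> I \<rightarrow>\<^sub>E V \<and> (\<forall>i\<in>I. (u i, v i) \<in> a i)}"

definition tensor_power :: "'i set \<Rightarrow> 'a set \<Rightarrow> ('a \<times> 'a) set set \<Rightarrow> (('i \<Rightarrow> 'a) \<times> ('i \<Rightarrow> 'a)) set set" where
  "tensor_power I V \<S> = tensor_rel I V ` (I \<rightarrow>\<^sub>E \<S>)"

definition sym_tensor_power :: "'i set \<Rightarrow> 'a set \<Rightarrow> ('a \<times> 'a) set set \<Rightarrow> (('i \<Rightarrow> 'a) \<times> ('i \<Rightarrow> 'a)) set set" where
  "sym_tensor_power I V \<S> =
     (\<lambda>a. \<Union>\<pi>\<in>{\<pi>. \<pi> permutes I}. tensor_rel I V (a \<circ> \<pi>)) ` (I \<rightarrow>\<^sub>E \<S>)"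

definition ksubsets :: "nat \<Rightarrow> nat \<Rightarrow> nat set set" where
  "ksubsets m k = {u. u \<subseteq> {1..m} \<and> card u = k}"

(* In the next three definitions the empty relation is removed, since it is not a class of a
   partition.  It arises only for degenerate parameters (m < 2k, resp. a one-element alphabet). *)

definition johnson_scheme :: "nat \<Rightarrow> nat \<Rightarrow> (nat set \<times> nat set) set set" where
  "johnson_scheme m k =
     (\<lambda>i. {(u, v). u \<in> ksubsets m k \<and> v \<in> ksubsets m k \<and> card (u - v) = i}) ` {0..k} - {{}}"

definition trivial_scheme :: "'a set \<Rightarrow> ('a \<times> 'a) set set" where
  "trivial_scheme A = {Id_on A, A \<times> A - Id_on A} - {{}}"

definition hamming_scheme :: "'i set \<Rightarrow> 'a set \<Rightarrow> (('i \<Rightarrow> 'a) \<times> ('i \<Rightarrow> 'a)) set set" where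
  "hamming_scheme I A =
     (\<lambda>j. {(x, y). x \<in> I \<rightarrow>\<^sub>E A \<and> y \<in> I \<rightarrow>\<^sub>E A \<and> card {i\<in>I. x i \<noteq> y i} = j}) ` {0..card I} - {{}}"

definition cameron_scheme :: "nat \<Rightarrow> nat \<Rightarrow> nat \<Rightarrow> ((nat \<Rightarrow> nat set) \<times> (nat \<Rightarrow> nat set)) set set" where
  "cameron_scheme m k d = sym_tensor_power {1..d} (ksubsets m k) (johnson_scheme m k)"

(* For a partition P of the coordinates into blocks of size e, regroup P e identifies V^d with
   (V^e)^P: the l-th entry of the B-component of x is the entry of x at the l-th smallest
   element of B. *)

definition regroup :: "nat set set \<Rightarrow> nat \<Rightarrow> (nat \<Rightarrow> 'a) \<Rightarrow> (nat set \<Rightarrow> nat \<Rightarrow> 'a)" where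
  "regroup P e x = (\<lambda>B\<in>P. \<lambda>l\<in>{1..e}. x (sorted_list_of_set B ! (l - 1)))"

definition transport :: "('a \<Rightarrow> 'b) \<Rightarrow> ('a \<times> 'a) set set \<Rightarrow> ('b \<times> 'b) set set" where
  "transport f \<X> = (\<lambda>R. map_prod f f ` R) ` \<X>"

lemma card_ksubsets_power: "card ({1..e} \<rightarrow>\<^sub>E ksubsets m k) = (m choose k) ^ e"
  by (simp add: card_PiE ksubsets_def n_subsets)

end

theory Submission
  imports Defs Complex_Main "HOL-Library.Multiset" "HOL-Library.Infinite_Set"
begin

text \<open>
  A relation of the tensor power is indexed by a vector \<open>a\<close> with entries at most \<open>k\<close>, and its valency
  grows like \<open>m\<close> to the weight \<open>a\<^sub>1 + \<dots> + a\<^sub>d\<close>. A fusion is an equivalence relation on these vectors. There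
  are only finitely many such equivalences, so it suffices to treat one that gives a primitive fusion
  for infinitely many \<open>m\<close>; for such an equivalence the limit as \<open>m \<rightarrow> \<infinity>\<close> of suitably normalised
  intersection numbers may be used.

  Let \<open>D\<close> be a class and \<open>w\<close> the largest weight of its elements. The intersection number
  of \<open>D, D\<close> at \<open>c\<close>, divided by \<open>m ^ w\<close>, tends to the sum of \<open>\<Prod>\<^sub>i ((k - c\<^sub>i) choose (k - a\<^sub>i)) / a\<^sub>i!\<close> over
  the elements \<open>a\<close> of \<open>D\<close> of weight \<open>w\<close>. A term is nonzero iff \<open>c \<le> a\<close>, so the elements of \<open>D\<close> all lie
  below its elements of top weight, and everything below these is a union of classes.

  Choose a nonzero class \<open>C\<close> with \<open>w\<close> minimal. Then \<open>C\<close> together with \<open>0\<close> is closed downwards and, by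
  primitivity, contains all unit vectors.
  If \<open>w = 1\<close>, then \<open>C\<close> is the set of unit vectors, the weight is the distance in the graph of \<open>C\<close> and
  hence a class invariant, and so is \<open>\<Prod>\<^sub>i c\<^sub>i!\<close>. Removing one unit at a time shows that equivalent vectors
  are permutations of each other.
  If \<open>w \<ge> 2\<close>, constancy of the limit on \<open>C\<close> forces the top elements of \<open>C\<close> to be \<open>k\<close> times the indicators
  of the blocks of a partition into blocks of equal size. The number of blocks met by a vector is
  the distance in the graph of \<open>C\<close>. Comparing the limits for an arbitrary class \<open>D\<close> at a
  unit vector and at a full block shows that the top elements of \<open>D\<close> are unions of full blocks. Hence
  each vector is equivalent to the full vector on the blocks that it meets.
\<close>

section \<open>Limits of intersection numbers\<close>

definition weight :: "'i set \<Rightarrow> ('i \<Rightarrow> nat) \<Rightarrow> nat" where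
  "weight I a = (\<Sum>i\<in>I. a i)"

definition top_part :: "'i set \<Rightarrow> ('i \<Rightarrow> nat) set \<Rightarrow> ('i \<Rightarrow> nat) set" where
  "top_part I D = {a \<in> D. weight I a = Max (weight I ` D)}"

text \<open>For entries at most \<open>k\<close>, factor \<open>i\<close> is the limit of the
  Johnson intersection number of \<open>a i\<close>, \<open>a i\<close> at \<open>c i\<close>,
  divided by \<open>m ^ a i\<close>; see \<open>inum_diag_tendsto\<close>.\<close>

definition overlap :: "nat \<Rightarrow> 'i set \<Rightarrow> ('i \<Rightarrow> nat) \<Rightarrow> ('i \<Rightarrow> nat) \<Rightarrow> real" where
  "overlap k I a c = (\<Prod>i\<in>I. real ((k - c i) choose (k - a i)) / fact (a i))"

definition leading :: "nat \<Rightarrow> 'i set \<Rightarrow> ('i \<Rightarrow> nat) set \<Rightarrow> ('i \<Rightarrow> nat) \<Rightarrow> real" where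
  "leading k I D c = (\<Sum>a\<in>top_part I D. overlap k I a c)"

lemma overlap_nonneg: "overlap k I a c \<ge> 0"
  unfolding overlap_def by (intro prod_nonneg) auto

lemma overlap_pos_iff:
  assumes "finite I" "a \<in> I \<rightarrow>\<^sub>E {..k}" "c \<in> I \<rightarrow>\<^sub>E {..k}"
  shows "overlap k I a c > 0 \<longleftrightarrow> (\<forall>i\<in>I. c i \<le> a i)"
proof -
  have "overlap k I a c > 0 \<longleftrightarrow> overlap k I a c \<noteq> 0"
    using overlap_nonneg[of k I a c] by linarith
  also have "\<dots> \<longleftrightarrow> (\<forall>i\<in>I. (k - c i) choose (k - a i) \<noteq> 0)"
    unfolding overlap_def using assms(1) by auto
  also have "\<dots> \<longleftrightarrow> (\<forall>i\<in>I. c i \<le> a i)"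
  proof (intro ball_cong refl)
    fix i assume "i \<in> I"
    then have "a i \<le> k" "c i \<le> k" using assms(2,3) by auto
    then show "((k - c i) choose (k - a i) \<noteq> 0) = (c i \<le> a i)"
      by (auto simp: binomial_eq_0_iff)
  qed
  finally show ?thesis .
qed

lemma overlap_antimono:
  assumes "\<And>i. i \<in> I \<Longrightarrow> c i \<le> c' i"
  shows "overlap k I a c' \<le> overlap k I a c"
  unfolding overlap_def
proof (intro prod_mono conjI)
  fix i assume "i \<in> I"
  then have "(k - c' i) choose (k - a i) \<le> (k - c i) choose (k - a i)"
    using assms by (intro binomial_right_mono) (simp add: diff_le_mono2)
  then show "real ((k - c' i) choose (k - a i)) / fact (a i)
      \<le> real ((k - c i) choose (k - a i)) / fact (a i)"
    by (intro divide_right_mono) auto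
qed auto

lemma weight_eq_imp_eq:
  assumes "finite I" "\<And>i. i \<in> I \<Longrightarrow> a i \<le> b i" "weight I b \<le> weight I a"
    and "a \<in> extensional I" "b \<in> extensional I"
  shows "a = b"
proof (rule extensionalityI[OF assms(4,5)])
  fix i assume i: "i \<in> I"
  show "a i = b i"
  proof (rule ccontr)
    assume "a i \<noteq> b i"
    then have "a i < b i" using assms(2)[OF i] by simp
    then have "weight I a < weight I b"
      unfolding weight_def using assms(1,2) i by (intro sum_strict_mono_ex1) auto
    with assms(3) show False by simp
  qed
qed

section \<open>Intersection numbers of the Johnson scheme\<close>

text \<open>Sliding intervals realise every distance up to \<open>k\<close> by sets that do not
  depend on \<open>m\<close>. Their offsets add: the interval at offset \<open>a\<close> lies on a
  shortest path from offset 0 to offset \<open>a + b\<close> when \<open>a + b \<le> k\<close>,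
  which \<open>E_compose\<close> exploits.\<close>

definition shifted :: "nat \<Rightarrow> nat \<Rightarrow> nat set" where
  "shifted k c = {c + 1..c + k}"

text \<open>For \<open>c \<le> k\<close> and \<open>2 * k \<le> m\<close> this is the intersection
  number of relations \<open>a\<close>, \<open>b\<close> at relation \<open>c\<close> of the Johnson
  scheme, evaluated at one representative pair.\<close>

definition inum :: "nat \<Rightarrow> nat \<Rightarrow> nat \<Rightarrow> nat \<Rightarrow> nat \<Rightarrow> nat" where
  "inum m k a b c =
     card {z \<in> ksubsets m k. card (shifted k 0 - z) = a \<and> card (z - shifted k c) = b}"

lemma finite_ksubsets: "finite (ksubsets m k)"
  unfolding ksubsets_def by (rule finite_subset[of _ "Pow {1..m}"]) auto

lemma ksubsetsD:
  assumes "z \<in> ksubsets m k"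
  shows "finite z" "card z = k" "z \<subseteq> {1..m}"
  using assms finite_subset[of z "{1..m}"] unfolding ksubsets_def by auto

lemma card_diff_sym: "finite u \<Longrightarrow> finite v \<Longrightarrow> card u = card v \<Longrightarrow> card (u - v) = card (v - u)"
  by (simp add: card_le_sym_Diff order_antisym)

lemma card_shifted [simp]: "card (shifted k c) = k" "finite (shifted k c)"
  unfolding shifted_def by auto

lemma card_shifted_diff:
  assumes "b \<le> k"
  shows "card (shifted k a - shifted k (a + b)) = b"
proof -
  have "shifted k a - shifted k (a + b) = {a + 1..a + b}"
    using assms unfolding shifted_def by auto
  then show ?thesis by simp
qed

lemma shifted_ksubsets: "c \<le> k \<Longrightarrow> 2 * k \<le> m \<Longrightarrow> shifted k c \<in> ksubsets m k"
  unfolding ksubsets_def shifted_def by auto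

text \<open>A set \<open>z\<close> is determined by its trace on \<open>y\<close> and its
  \<open>b\<close> points outside \<open>y\<close>. With \<open>card y = k\<close> this bounds a
  valency by order \<open>m ^ b\<close>.\<close>

lemma card_ksubsets_diff_le:
  assumes "finite y"
  shows "card {z \<in> ksubsets m k. card (z - y) = b} \<le> 2 ^ card y * m ^ b"
proof -
  let ?Z = "{z \<in> ksubsets m k. card (z - y) = b}"
  let ?T = "Pow y \<times> {s. s \<subseteq> {1..m} \<and> card s = b}"
  have fin: "finite {s. s \<subseteq> {1..m} \<and> card s = b}"
    by (rule finite_subset[of _ "Pow {1..m}"]) auto
  have "card ?Z \<le> card ?T"
  proof (rule card_inj_on_le)
    show "inj_on (\<lambda>z. (z \<inter> y, z - y)) ?Z" by (rule inj_onI) blast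
    show "(\<lambda>z. (z \<inter> y, z - y)) ` ?Z \<subseteq> ?T" unfolding ksubsets_def by auto
    show "finite ?T" using assms fin by auto
  qed
  also have "\<dots> = 2 ^ card y * (m choose b)"
    using assms by (simp add: card_cartesian_product card_Pow n_subsets)
  also have "(m choose b) \<le> m ^ b" by (cases "b \<le> m") (auto intro: binomial_le_pow simp: binomial_eq_0)
  then have "2 ^ card y * (m choose b) \<le> 2 ^ card y * m ^ b" by simp
  finally show ?thesis .
qed

text \<open>Either distance condition alone bounds the count, so the smaller exponent is available.
  This is what makes the terms with distinct \<open>a\<close> and \<open>b\<close> negligible in
  \<open>prod_inum_tendsto\<close>.\<close>

lemma inum_le: "inum m k a b c \<le> 2 ^ k * m ^ min a b"
proof -
  have "inum m k a b c \<le> card {z \<in> ksubsets m k. card (z - shifted k 0) = a}"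
    unfolding inum_def
  proof (rule card_mono)
    show "{z \<in> ksubsets m k. card (shifted k 0 - z) = a \<and> card (z - shifted k c) = b}
      \<subseteq> {z \<in> ksubsets m k. card (z - shifted k 0) = a}"
    proof
      fix z assume z: "z \<in> {z \<in> ksubsets m k. card (shifted k 0 - z) = a \<and> card (z - shifted k c) = b}"
      then have "card (z - shifted k 0) = card (shifted k 0 - z)"
        using ksubsetsD[of z m k] by (intro card_diff_sym) auto
      then show "z \<in> {z \<in> ksubsets m k. card (z - shifted k 0) = a}" using z by simp
    qed
  qed (use finite_ksubsets in auto)
  also have "\<dots> \<le> 2 ^ k * m ^ a" using card_ksubsets_diff_le[of "shifted k 0"] by simp
  finally have 1: "inum m k a b c \<le> 2 ^ k * m ^ a" .
  have "inum m k a b c \<le> card {z \<in> ksubsets m k. card (z - shifted k c) = b}"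
    unfolding inum_def using finite_ksubsets by (intro card_mono) auto
  also have "\<dots> \<le> 2 ^ k * m ^ b" using card_ksubsets_diff_le[of "shifted k c"] by simp
  finally show ?thesis using 1 by (simp add: min_def)
qed

text \<open>Up to the factor \<open>1 / fact j\<close> the binomial is a product of \<open>j\<close>
  factors asymptotic to \<open>m\<close>; for \<open>j < a\<close> a positive power of
  \<open>1 / m\<close> is left over. The fixed shift \<open>n\<close> does not affect the
  limit.\<close>

lemma binomial_over_power_tendsto:
  assumes "j \<le> a"
  shows "(\<lambda>m. real ((m - n) choose j) / real m ^ a) \<longlonglongrightarrow> (if j = a then 1 / fact a else 0)"
proof -
  have factor: "(\<lambda>m. (real (m - n) - real i) / real m) \<longlonglongrightarrow> 1" for i
  proof -
    have "(\<lambda>m. 1 - real (n + i) / real m) \<longlonglongrightarrow> 1 - 0"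
      by (intro tendsto_intros lim_const_over_n)
    moreover have "\<forall>\<^sub>F m in sequentially. 1 - real (n + i) / real m = (real (m - n) - real i) / real m"
      using eventually_ge_at_top[of "Suc n"]
      by eventually_elim (simp add: field_simps of_nat_diff)
    ultimately show ?thesis by (simp add: tendsto_cong)
  qed
  have "(\<lambda>m. (\<Prod>i<j. (real (m - n) - real i) / real m) / fact j) \<longlonglongrightarrow> (\<Prod>i<j. 1) / fact j"
    by (intro tendsto_divide tendsto_prod factor tendsto_const) simp
  then have lim: "(\<lambda>m. real ((m - n) choose j) / real m ^ j) \<longlonglongrightarrow> 1 / fact j"
    by (simp add: binomial_gbinomial gbinomial_prod_rev prod_dividef atLeast0LessThan mult.commute)
  show ?thesis
  proof (cases "j = a")
    case True
    then show ?thesis using lim by simp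
  next
    case False
    have "(\<lambda>m. (1 / real m) ^ (a - j)) \<longlonglongrightarrow> 0 ^ (a - j)"
      by (intro tendsto_power lim_const_over_n)
    then have "(\<lambda>m. real ((m - n) choose j) / real m ^ j * (1 / real m) ^ (a - j)) \<longlonglongrightarrow> 1 / fact j * 0"
      using False assms by (intro tendsto_mult lim) (simp add: zero_power)
    moreover have "real ((m - n) choose j) / real m ^ j * (1 / real m) ^ (a - j)
        = real ((m - n) choose j) / real m ^ a" for m
      using assms by (simp add: power_divide power_add[symmetric])
    ultimately show ?thesis using False by simp
  qed
qed

text \<open>The sets are sorted by their trace \<open>t\<close> on \<open>T\<close>; the remaining
  \<open>k - card t\<close> points are chosen freely outside \<open>T\<close>. The bound on
  \<open>card t\<close> guards the truncated subtraction.\<close>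

lemma card_split_ksubsets:
  assumes T: "T \<subseteq> {1..m}" and F: "F \<subseteq> Pow T" "\<And>t. t \<in> F \<Longrightarrow> card t \<le> k"
  shows "card {z \<in> ksubsets m k. z \<inter> T \<in> F} = (\<Sum>t\<in>F. (m - card T) choose (k - card t))"
proof -
  have finT: "finite T" using T by (rule finite_subset) simp
  have finF: "finite F" using F(1) by (rule finite_subset) (simp add: finT)
  define S where "S t = {s. s \<subseteq> {1..m} - T \<and> card s = k - card t}" for t :: "nat set"
  have finS: "finite (S t)" for t unfolding S_def
    by (rule finite_subset[of _ "Pow {1..m}"]) auto
  have "{z \<in> ksubsets m k. z \<inter> T \<in> F} = (\<Union>t\<in>F. (\<union>) t ` S t)"
  proof (intro equalityI subsetI)
    fix z assume z: "z \<in> {z \<in> ksubsets m k. z \<inter> T \<in> F}"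
    then have "finite z" "card z = k" "z \<subseteq> {1..m}"
      using ksubsetsD[of z m k] by auto
    moreover have "card (z - T) = card z - card (z \<inter> T)"
      using finT by (simp add: card_Diff_subset_Int)
    ultimately have "z - T \<in> S (z \<inter> T)" unfolding S_def by auto
    moreover have "z = (z \<inter> T) \<union> (z - T)" by blast
    ultimately show "z \<in> (\<Union>t\<in>F. (\<union>) t ` S t)" using z by blast
  next
    fix z assume "z \<in> (\<Union>t\<in>F. (\<union>) t ` S t)"
    then obtain t s where ts: "t \<in> F" "s \<subseteq> {1..m} - T" "card s = k - card t" "z = t \<union> s"
      unfolding S_def by auto
    have tT: "t \<subseteq> T" using F ts by auto
    then have "z \<inter> T = t" using ts by auto
    moreover have "card z = card t + card s" unfolding ts(4)
      using ts(2) tT finT finite_subset[of s "{1..m}"] finite_subset[OF tT]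
      by (intro card_Un_disjoint) auto
    ultimately show "z \<in> {z \<in> ksubsets m k. z \<inter> T \<in> F}"
      using ts T tT F(2)[OF ts(1)] unfolding ksubsets_def by auto
  qed
  also have "card \<dots> = (\<Sum>t\<in>F. card ((\<union>) t ` S t))"
  proof (rule card_UN_disjoint[OF finF])
    show "\<forall>i\<in>F. finite ((\<union>) i ` S i)" using finS by auto
    have "(t \<union> s) \<inter> T = t" if "t \<in> F" "s \<in> S t" for t s
      using that F(1) unfolding S_def by auto
    then show "\<forall>i\<in>F. \<forall>j\<in>F. i \<noteq> j \<longrightarrow> (\<union>) i ` S i \<inter> (\<union>) j ` S j = {}" by blast
  qed
  also have "\<dots> = (\<Sum>t\<in>F. (m - card T) choose (k - card t))"
  proof (intro sum.cong refl)
    fix t assume t: "t \<in> F"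
    have "inj_on ((\<union>) t) (S t)"
    proof (rule inj_onI)
      fix s s' assume s: "s \<in> S t" "s' \<in> S t" "t \<union> s = t \<union> s'"
      have "t \<subseteq> T" using F(1) t by blast
      then have "s \<inter> t = {}" "s' \<inter> t = {}" using s(1,2) unfolding S_def by blast+
      then show "s = s'" using s(3) by blast
    qed
    then have "card ((\<union>) t ` S t) = card (S t)" by (rule card_image)
    also have "\<dots> = (m - card T) choose (k - card t)"
      unfolding S_def using T finT by (simp add: n_subsets card_Diff_subset)
    finally show "card ((\<union>) t ` S t) = (m - card T) choose (k - card t)" .
  qed
  finally show ?thesis .
qed

text \<open>A trace \<open>t\<close> on the union of the two intervals contributes order
  \<open>m ^ (k - card t)\<close>. The distance conditions give \<open>t\<close> exactly
  \<open>k - a\<close> points in each interval, so the exponent is at most \<open>a\<close>, with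
  equality iff \<open>t\<close> lies in the intersection. That intersection has \<open>k - c\<close>
  points, which yields the binomial coefficient, and each such trace has limit
  \<open>1 / fact a\<close>.\<close>

lemma inum_diag_tendsto:
  assumes "a \<le> k" "c \<le> k"
  shows "(\<lambda>m. real (inum m k a a c) / real m ^ a) \<longlonglongrightarrow> real ((k - c) choose (k - a)) / fact a"
proof -
  let ?x = "shifted k 0" and ?y = "shifted k c"
  define T where "T = ?x \<union> ?y"
  \<comment> \<open>The condition on \<open>z - ?y\<close> is replaced by the one on
    \<open>?y - z\<close>, a set that is determined by the trace of \<open>z\<close> on
    \<open>T\<close>.\<close>
  define F where "F = {t \<in> Pow T. card (?x - t) = a \<and> card (?y - t) = a \<and> card t \<le> k}"
  have finT: "finite T" unfolding T_def by simp
  have finF: "finite F" unfolding F_def using finT by simp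
  have exact: "inum m k a a c = (\<Sum>t\<in>F. (m - card T) choose (k - card t))" if m: "2 * k \<le> m" for m
  proof -
    have "{z \<in> ksubsets m k. card (?x - z) = a \<and> card (z - ?y) = a} = {z \<in> ksubsets m k. z \<inter> T \<in> F}"
    proof (rule Collect_cong, rule conj_cong[OF refl])
      fix z assume z: "z \<in> ksubsets m k"
      then have fz: "finite z" "card z = k" using ksubsetsD by auto
      have "?x - z \<inter> T = ?x - z" "?y - z \<inter> T = ?y - z" unfolding T_def by auto
      moreover have "card (z - ?y) = card (?y - z)" using fz by (intro card_diff_sym) auto
      moreover have "card (z \<inter> T) \<le> k" using fz card_mono[of z "z \<inter> T"] by auto
      ultimately show "(card (?x - z) = a \<and> card (z - ?y) = a) = (z \<inter> T \<in> F)"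
        unfolding F_def by auto
    qed
    moreover have "T \<subseteq> {1..m}" using m assms unfolding T_def shifted_def by auto
    moreover have "F \<subseteq> Pow T" "\<And>t. t \<in> F \<Longrightarrow> card t \<le> k" unfolding F_def by auto
    ultimately show ?thesis
      unfolding inum_def using card_split_ksubsets[of T m F k] by simp
  qed
  have le: "k - card t \<le> a" and iff: "k - card t = a \<longleftrightarrow> t \<subseteq> ?x \<inter> ?y" if t: "t \<in> F" for t
  proof -
    have ft: "card t \<le> k" "t \<subseteq> T" using t unfolding F_def by auto
    have ft3: "finite t" using ft(2) finT by (rule finite_subset)
    have "card (?x - t) = k - card (?x \<inter> t)" "card (?y - t) = k - card (?y \<inter> t)"
      using ft ft3 by (simp_all add: card_Diff_subset_Int)
    moreover have lex: "card (?x \<inter> t) \<le> card t" "card (?y \<inter> t) \<le> card t" using ft3 by (auto intro: card_mono)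
    moreover have "card (?x \<inter> t) \<le> k" "card (?y \<inter> t) \<le> k"
      using card_mono[of ?x "?x \<inter> t"] card_mono[of ?y "?y \<inter> t"] by auto
    ultimately have cx: "card (?x \<inter> t) = k - a" "card (?y \<inter> t) = k - a"
      using t assms unfolding F_def by auto
    then show "k - card t \<le> a" using lex by auto
    show "k - card t = a \<longleftrightarrow> t \<subseteq> ?x \<inter> ?y"
    proof
      assume "k - card t = a"
      then have "card (?x \<inter> t) = card t" "card (?y \<inter> t) = card t" using cx ft by auto
      then have "?x \<inter> t = t" "?y \<inter> t = t"
        using card_subset_eq[OF ft3 Int_lower2] by blast+
      then show "t \<subseteq> ?x \<inter> ?y" by blast
    next
      assume "t \<subseteq> ?x \<inter> ?y"
      then have "?x \<inter> t = t" by blast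
      then show "k - card t = a" using cx assms by simp
    qed
  qed
  have "(\<lambda>m. \<Sum>t\<in>F. real ((m - card T) choose (k - card t)) / real m ^ a)
    \<longlonglongrightarrow> (\<Sum>t\<in>F. if k - card t = a then 1 / fact a else 0)"
    by (intro tendsto_sum binomial_over_power_tendsto le)
  moreover have "\<forall>\<^sub>F m in sequentially. (\<Sum>t\<in>F. real ((m - card T) choose (k - card t)) / real m ^ a)
    = real (inum m k a a c) / real m ^ a"
    using eventually_ge_at_top[of "2 * k"]
    by eventually_elim (simp add: exact sum_divide_distrib)
  ultimately have lim: "(\<lambda>m. real (inum m k a a c) / real m ^ a)
    \<longlonglongrightarrow> (\<Sum>t\<in>F. if k - card t = a then 1 / fact a else 0)"
    by (simp add: tendsto_cong)
  have "(\<Sum>t\<in>F. if k - card t = a then 1 / fact a else 0)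
    = (\<Sum>t\<in>{t \<in> F. k - card t = a}. 1 / fact a :: real)"
    using finF by (simp only: sum.inter_filter)
  also have "{t \<in> F. k - card t = a} = {t. t \<subseteq> ?x \<inter> ?y \<and> card t = k - a}"
  proof (intro equalityI subsetI)
    fix t assume t: "t \<in> {t \<in> F. k - card t = a}"
    then have "t \<subseteq> ?x \<inter> ?y" "card t \<le> k" using iff unfolding F_def by auto
    then show "t \<in> {t. t \<subseteq> ?x \<inter> ?y \<and> card t = k - a}" using t by auto
  next
    fix t assume t: "t \<in> {t. t \<subseteq> ?x \<inter> ?y \<and> card t = k - a}"
    then have "finite t" using finite_subset[of t ?x] by auto
    then have "card (?x - t) = a" "card (?y - t) = a"
      using t assms by (auto simp: card_Diff_subset)
    then show "t \<in> {t \<in> F. k - card t = a}" using t assms unfolding F_def T_def by auto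
  qed
  also have "(\<Sum>t\<in>\<dots>. 1 / fact a :: real) = real (card (?x \<inter> ?y) choose (k - a)) / fact a"
    using n_subsets[of "?x \<inter> ?y" "k - a"] by (simp del: Int_subset_iff)
  also have "?x \<inter> ?y = {c + 1..k}" unfolding shifted_def by auto
  finally show ?thesis using lim by simp
qed

text \<open>Here \<open>a\<close> and \<open>b\<close> are the distance vectors of the two steps of
  a path; \<open>card_paths\<close> identifies the sum with the intersection number of a class with
  itself, where \<open>D\<close> is the index set of the class.\<close>

definition path_count :: "nat \<Rightarrow> nat \<Rightarrow> 'i set \<Rightarrow> ('i \<Rightarrow> nat) set \<Rightarrow> ('i \<Rightarrow> nat) \<Rightarrow> nat" where
  "path_count m k I D c = (\<Sum>a\<in>D. \<Sum>b\<in>D. \<Prod>i\<in>I. inum m k (a i) (b i) (c i))"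

text \<open>The product is at most a constant times \<open>m\<close> to the sum of the minima of
  \<open>a i\<close> and \<open>b i\<close>. That sum reaches \<open>w\<close> only if
  \<open>a = b\<close> has weight \<open>w\<close>, and then the coordinatewise limits multiply.
  Otherwise a positive power of \<open>1 / m\<close> forces the limit 0.\<close>

lemma prod_inum_tendsto:
  assumes I: "finite I" and L: "a \<in> I \<rightarrow>\<^sub>E {..k}" "b \<in> I \<rightarrow>\<^sub>E {..k}" "c \<in> I \<rightarrow>\<^sub>E {..k}"
    and w: "weight I a \<le> w" "weight I b \<le> w"
  shows "(\<lambda>m. real (\<Prod>i\<in>I. inum m k (a i) (b i) (c i)) / real m ^ w)
    \<longlonglongrightarrow> (if a = b \<and> weight I a = w then overlap k I a c else 0)"
proof (cases "a = b \<and> weight I a = w")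
  case True
  have "(\<lambda>m. \<Prod>i\<in>I. real (inum m k (a i) (a i) (c i)) / real m ^ a i) \<longlonglongrightarrow> overlap k I a c"
    unfolding overlap_def using L by (intro tendsto_prod inum_diag_tendsto) auto
  moreover have "(\<Prod>i\<in>I. real (inum m k (a i) (a i) (c i)) / real m ^ a i)
    = real (\<Prod>i\<in>I. inum m k (a i) (b i) (c i)) / real m ^ w" for m
    using True by (auto simp: prod_dividef weight_def power_sum)
  ultimately have "(\<lambda>m. real (\<Prod>i\<in>I. inum m k (a i) (b i) (c i)) / real m ^ w) \<longlonglongrightarrow> overlap k I a c" by simp
  then show ?thesis by (subst if_P[OF True])
next
  case False
  define s where "s = (\<Sum>i\<in>I. min (a i) (b i))"
  have sw: "s < w"
  proof (rule ccontr)
    assume "\<not> s < w"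
    then have s: "weight I a \<le> weight I (\<lambda>i\<in>I. min (a i) (b i))" "weight I b \<le> weight I (\<lambda>i\<in>I. min (a i) (b i))"
      "w \<le> weight I (\<lambda>i\<in>I. min (a i) (b i))"
      using w unfolding s_def weight_def by simp_all
    have ext: "a \<in> extensional I" "b \<in> extensional I" using L by (auto simp: PiE_def)
    have "(\<lambda>i\<in>I. min (a i) (b i)) = a" using s(1) ext by (intro weight_eq_imp_eq[OF I]) auto
    moreover have "(\<lambda>i\<in>I. min (a i) (b i)) = b" using s(2) ext by (intro weight_eq_imp_eq[OF I]) auto
    ultimately show False using False s w by auto
  qed
  have bound: "real (\<Prod>i\<in>I. inum m k (a i) (b i) (c i)) / real m ^ w
      \<le> (2 ^ k) ^ card I * (1 / real m) ^ (w - s)" if "m \<ge> 1" for m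
  proof -
    have "(\<Prod>i\<in>I. inum m k (a i) (b i) (c i)) \<le> (\<Prod>i\<in>I. 2 ^ k * m ^ min (a i) (b i))"
      by (intro prod_mono) (auto intro: inum_le)
    also have "\<dots> = (2 ^ k) ^ card I * m ^ s"
      unfolding s_def by (simp add: prod.distrib power_sum)
    finally have "real (\<Prod>i\<in>I. inum m k (a i) (b i) (c i)) \<le> (2 ^ k) ^ card I * real m ^ s"
      by (metis (mono_tags, lifting) of_nat_le_iff of_nat_mult of_nat_numeral of_nat_power)
    then have "real (\<Prod>i\<in>I. inum m k (a i) (b i) (c i)) / real m ^ w
      \<le> (2 ^ k) ^ card I * real m ^ s / real m ^ w" by (intro divide_right_mono) auto
    also have "\<dots> = (2 ^ k) ^ card I * real m ^ s / (real m ^ s * real m ^ (w - s))"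
      using sw by (simp add: power_add[symmetric])
    also have "\<dots> = (2 ^ k) ^ card I * (1 / real m) ^ (w - s)"
      using that by (simp add: power_divide)
    finally show ?thesis .
  qed
  have "(\<lambda>m. (2 ^ k) ^ card I * (1 / real m) ^ (w - s)) \<longlonglongrightarrow> (2 ^ k) ^ card I * 0 ^ (w - s)"
    by (intro tendsto_mult tendsto_const tendsto_power lim_const_over_n)
  then have lim: "(\<lambda>m. (2 ^ k) ^ card I * (1 / real m) ^ (w - s)) \<longlonglongrightarrow> 0"
    using sw by (simp add: zero_power)
  have "(\<lambda>m. real (\<Prod>i\<in>I. inum m k (a i) (b i) (c i)) / real m ^ w) \<longlonglongrightarrow> 0"
  proof (rule tendsto_sandwich[OF _ _ tendsto_const[of 0]])
    show "\<forall>\<^sub>F m in sequentially. real (\<Prod>i\<in>I. inum m k (a i) (b i) (c i)) / real m ^ w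
      \<le> (2 ^ k) ^ card I * (1 / real m) ^ (w - s)"
      using eventually_ge_at_top[of 1] by eventually_elim (rule bound)
  qed (simp_all add: lim prod_nonneg)
  then show ?thesis by (subst if_not_P[OF False])
qed

lemma path_count_tendsto:
  assumes I: "finite I" and D: "D \<subseteq> I \<rightarrow>\<^sub>E {..k}" and c: "c \<in> I \<rightarrow>\<^sub>E {..k}"
  shows "(\<lambda>m. real (path_count m k I D c) / real m ^ Max (weight I ` D)) \<longlonglongrightarrow> leading k I D c"
proof -
  let ?w = "Max (weight I ` D)"
  have finD: "finite D" using I by (intro finite_subset[OF D] finite_PiE) auto
  have w: "weight I a \<le> ?w" if "a \<in> D" for a using that finD by auto
  have "(\<lambda>m. \<Sum>a\<in>D. \<Sum>b\<in>D. real (\<Prod>i\<in>I. inum m k (a i) (b i) (c i)) / real m ^ ?w)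
    \<longlonglongrightarrow> (\<Sum>a\<in>D. \<Sum>b\<in>D. if a = b \<and> weight I a = ?w then overlap k I a c else 0)"
    using D w c by (intro tendsto_sum prod_inum_tendsto[OF I]) auto
  moreover have "(\<Sum>a\<in>D. \<Sum>b\<in>D. if a = b \<and> weight I a = ?w then overlap k I a c else 0)
    = (\<Sum>a\<in>D. if weight I a = ?w then overlap k I a c else 0)"
  proof (intro sum.cong refl)
    fix a assume "a \<in> D"
    have "(\<Sum>b\<in>D. if a = b \<and> weight I a = ?w then overlap k I a c else 0)
      = (\<Sum>b\<in>D. if a = b then (if weight I a = ?w then overlap k I a c else 0) else 0)"
      by (intro sum.cong) auto
    also have "\<dots> = (if weight I a = ?w then overlap k I a c else 0)"
      using finD \<open>a \<in> D\<close> by simp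
    finally show "(\<Sum>b\<in>D. if a = b \<and> weight I a = ?w then overlap k I a c else 0)
      = (if weight I a = ?w then overlap k I a c else 0)" .
  qed
  moreover have "\<dots> = leading k I D c"
    unfolding leading_def top_part_def using finD by (simp only: sum.inter_filter)
  moreover have "(\<Sum>a\<in>D. \<Sum>b\<in>D. real (\<Prod>i\<in>I. inum m k (a i) (b i) (c i)) / real m ^ ?w)
    = real (path_count m k I D c) / real m ^ ?w" for m
    unfolding path_count_def by (simp add: sum_divide_distrib)
  ultimately show ?thesis by simp
qed

text \<open>Both normalised sequences converge, so agreement along a subsequence already identifies
  their limits.\<close>

lemma leading_eq_if_infinitely_often:
  assumes "finite I" "D \<subseteq> I \<rightarrow>\<^sub>E {..k}" "c \<in> I \<rightarrow>\<^sub>E {..k}" "c' \<in> I \<rightarrow>\<^sub>E {..k}"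
    and inf: "infinite M" and eq: "\<And>m. m \<in> M \<Longrightarrow> path_count m k I D c = path_count m k I D c'"
  shows "leading k I D c = leading k I D c'"
proof -
  obtain r :: "nat \<Rightarrow> nat" where r: "strict_mono r" "\<forall>n. r n \<in> M"
    using infinite_enumerate[OF inf] by blast
  let ?f = "\<lambda>c m. real (path_count m k I D c) / real m ^ Max (weight I ` D)"
  have lim: "(?f c \<circ> r) \<longlonglongrightarrow> leading k I D c" "(?f c' \<circ> r) \<longlonglongrightarrow> leading k I D c'"
    using path_count_tendsto[OF assms(1,2)] assms(3,4) r(1) by (auto intro: LIMSEQ_subseq_LIMSEQ)
  have "?f c \<circ> r = ?f c' \<circ> r" using eq r(2) by (auto simp: fun_eq_iff)
  then show ?thesis using LIMSEQ_unique[OF lim(1)] lim(2) by simp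
qed

section \<open>Classification of the limit equivalences\<close>

definition supp_on :: "'i set \<Rightarrow> ('i \<Rightarrow> nat) \<Rightarrow> 'i set" where
  "supp_on I a = {i \<in> I. a i \<noteq> 0}"

definition touched :: "'i set set \<Rightarrow> ('i \<Rightarrow> nat) \<Rightarrow> 'i set set" where
  "touched P a = {B \<in> P. \<exists>i\<in>B. a i \<noteq> 0}"

text \<open>Equal multisets of entries mean equality up to a permutation of coordinates, that is,
  the same relation of the Cameron scheme.\<close>

definition cameron_type :: "'i set \<Rightarrow> (('i \<Rightarrow> nat) \<times> ('i \<Rightarrow> nat)) set \<Rightarrow> bool" where
  "cameron_type I E \<longleftrightarrow> (\<forall>(c, c')\<in>E. image_mset c (mset_set I) = image_mset c' (mset_set I))"

text \<open>Applied to a distance vector, \<open>touched P\<close> is the set of blocks in which two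
  points differ. Hence the third clause places the fusion above the tensor power of the trivial
  scheme, and the fourth places it below the Hamming scheme.\<close>

definition hamming_type :: "'i set \<Rightarrow> nat \<Rightarrow> (('i \<Rightarrow> nat) \<times> ('i \<Rightarrow> nat)) set \<Rightarrow> nat \<Rightarrow> 'i set set \<Rightarrow> bool" where
  "hamming_type I k E e P \<longleftrightarrow> partition_on I P \<and> (\<forall>B\<in>P. card B = e) \<and>
     (\<forall>c\<in>I \<rightarrow>\<^sub>E {..k}. \<forall>c'\<in>I \<rightarrow>\<^sub>E {..k}. touched P c = touched P c' \<longrightarrow> (c, c') \<in> E) \<and>
     (\<forall>(c, c')\<in>E. card (touched P c) = card (touched P c'))"

text \<open>Where \<open>a i = k\<close> the factor is \<open>1 / fact k\<close> whatever
  \<open>c i\<close> is; where \<open>a i = 0\<close> also \<open>c i = 0\<close>, and the factor is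
  1.\<close>

lemma overlap_full:
  assumes "finite I" "\<forall>i\<in>I. a i = 0 \<or> a i = k" "\<forall>i\<in>I. c i \<le> a i"
  shows "overlap k I a c = (1 / fact k) ^ card (supp_on I a)"
proof -
  have "overlap k I a c = (\<Prod>i\<in>I. if a i \<noteq> 0 then 1 / fact k else 1)"
    unfolding overlap_def
  proof (intro prod.cong refl)
    fix i assume "i \<in> I"
    then show "real (k - c i choose (k - a i)) / fact (a i) = (if a i \<noteq> 0 then 1 / fact k else 1)"
      using assms(2,3) by (cases "a i = 0") force+
  qed
  also have "\<dots> = (\<Prod>i\<in>supp_on I a. 1 / fact k)"
    unfolding supp_on_def using assms(1) by (simp add: prod.inter_filter[symmetric])
  finally show ?thesis by simp
qed

text \<open>These are the traces left on index vectors by primitive fusions that induce the same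
  \<open>E\<close> for infinitely many \<open>m\<close>: \<open>zero_class\<close> comes from the
  diagonal, \<open>cover\<close> from primitivity, \<open>compose\<close> from a positive
  intersection number and the triangle inequality, and \<open>leading_eq\<close> from the
  limit.\<close>

locale limit_fusion =
  fixes I :: "'i set" and k :: nat and E :: "(('i \<Rightarrow> nat) \<times> ('i \<Rightarrow> nat)) set"
  assumes fin: "finite I" and I_ne: "I \<noteq> {}" and k_pos: "k > 0"
    and equivE: "equiv (I \<rightarrow>\<^sub>E {..k}) E"
    and zero_class: "\<And>a. (\<lambda>i\<in>I. 0, a) \<in> E \<Longrightarrow> a = (\<lambda>i\<in>I. 0)"
    and cover: "\<And>a i. a \<in> I \<rightarrow>\<^sub>E {..k} \<Longrightarrow> a \<noteq> (\<lambda>i\<in>I. 0) \<Longrightarrow> i \<in> I \<Longrightarrow>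
      \<exists>b. (a, b) \<in> E \<and> b i \<noteq> 0"
    and compose: "\<And>a b c c'. (c, c') \<in> E \<Longrightarrow> a \<in> I \<rightarrow>\<^sub>E {..k} \<Longrightarrow> b \<in> I \<rightarrow>\<^sub>E {..k} \<Longrightarrow>
      \<forall>i\<in>I. c i = a i + b i \<Longrightarrow>
      \<exists>a' b'. (a, a') \<in> E \<and> (b, b') \<in> E \<and> (\<forall>i\<in>I. c' i \<le> a' i + b' i)"
    and leading_eq: "\<And>x c c'. x \<in> I \<rightarrow>\<^sub>E {..k} \<Longrightarrow> (c, c') \<in> E \<Longrightarrow>
      leading k I (E `` {x}) c = leading k I (E `` {x}) c'"
begin

abbreviation "L \<equiv> I \<rightarrow>\<^sub>E {..k}"
abbreviation "zero \<equiv> (\<lambda>i\<in>I. 0::nat)"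
abbreviation "unit_vec j \<equiv> (\<lambda>i\<in>I. if i = j then 1 else (0::nat))"
abbreviation "cls x \<equiv> E `` {x}"
abbreviation "tops x \<equiv> top_part I (cls x)"
abbreviation "deg x \<equiv> Max (weight I ` cls x)"

lemma finL: "finite L" using fin by (intro finite_PiE) auto
lemma E_sub: "(a, b) \<in> E \<Longrightarrow> a \<in> L \<and> b \<in> L"
  using equivE unfolding equiv_def refl_on_def by auto
lemma E_refl: "a \<in> L \<Longrightarrow> (a, a) \<in> E"
  using equivE unfolding equiv_def refl_on_def by auto
lemma E_sym: "(a, b) \<in> E \<Longrightarrow> (b, a) \<in> E"
  using equivE unfolding equiv_def by (meson symE)
lemma E_trans: "(a, b) \<in> E \<Longrightarrow> (b, c) \<in> E \<Longrightarrow> (a, c) \<in> E"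
  using equivE unfolding equiv_def by (meson transE)
lemma unit_in: "unit_vec j \<in> L" using k_pos by auto
lemma L_le: "a \<in> L \<Longrightarrow> i \<in> I \<Longrightarrow> a i \<le> k" by auto
lemma L_ext: "a \<in> L \<Longrightarrow> a \<in> extensional I" by (auto simp: PiE_def)
lemma cls_sub: "cls x \<subseteq> L" using E_sub by auto
lemma fin_cls: "finite (cls x)" using cls_sub finL by (rule finite_subset)
lemma tops_sub: "tops x \<subseteq> cls x" unfolding top_part_def by auto
lemma fin_tops: "finite (tops x)" using tops_sub fin_cls by (rule finite_subset)
lemma tops_L: "a \<in> tops x \<Longrightarrow> a \<in> L" using tops_sub cls_sub by blast

lemma zero_iff: "a \<in> L \<Longrightarrow> a = zero \<longleftrightarrow> (\<forall>i\<in>I. a i = 0)"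
  by (auto intro!: extensionalityI[of _ I] simp: PiE_def)

lemma weight_zero_iff: "a \<in> L \<Longrightarrow> weight I a = 0 \<longleftrightarrow> a = zero"
  using zero_iff fin by (auto simp: weight_def)

lemma tops_nonempty: "x \<in> L \<Longrightarrow> \<exists>a. a \<in> tops x"
proof -
  assume "x \<in> L"
  then have "weight I ` cls x \<noteq> {}" using E_refl by auto
  then have "deg x \<in> weight I ` cls x" using fin_cls by (intro Max_in) auto
  then show ?thesis unfolding top_part_def by auto
qed

lemma weight_le_deg: "a \<in> cls x \<Longrightarrow> weight I a \<le> deg x"
  using fin_cls by (intro Max_ge) auto

lemma weight_tops: "a \<in> tops x \<Longrightarrow> weight I a = deg x"
  unfolding top_part_def by auto

lemma tops_le_eq:
  assumes "a \<in> tops x" "b \<in> cls x" "\<forall>i\<in>I. a i \<le> b i"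
  shows "a = b"
  using assms(3) weight_tops[OF assms(1)] weight_le_deg[OF assms(2)]
    L_ext[OF tops_L[OF assms(1)]] L_ext[OF subsetD[OF cls_sub assms(2)]]
  by (intro weight_eq_imp_eq[OF fin]) auto

lemma leading_pos_iff:
  assumes "c \<in> L"
  shows "leading k I (cls x) c > 0 \<longleftrightarrow> (\<exists>a\<in>tops x. \<forall>i\<in>I. c i \<le> a i)"
proof -
  have "leading k I (cls x) c > 0 \<longleftrightarrow> leading k I (cls x) c \<noteq> 0"
    using sum_nonneg[of "tops x" "\<lambda>a. overlap k I a c"] overlap_nonneg
    unfolding leading_def by (metis less_le)
  also have "\<dots> \<longleftrightarrow> (\<exists>a\<in>tops x. overlap k I a c \<noteq> 0)"
    unfolding leading_def using fin_tops overlap_nonneg by (subst sum_nonneg_eq_0_iff) auto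
  also have "\<dots> \<longleftrightarrow> (\<exists>a\<in>tops x. overlap k I a c > 0)"
    using overlap_nonneg by (metis less_le)
  also have "\<dots> \<longleftrightarrow> (\<exists>a\<in>tops x. \<forall>i\<in>I. c i \<le> a i)"
    using overlap_pos_iff[OF fin] tops_L assms by auto
  finally show ?thesis .
qed

text \<open>\<open>leading\<close> is positive at a top element and constant on the class, hence
  positive at \<open>c\<close>; a positive summand belongs to a top element above
  \<open>c\<close>.\<close>

lemma below_top:
  assumes "c \<in> cls x" shows "\<exists>a\<in>tops x. \<forall>i\<in>I. c i \<le> a i"
proof -
  have x: "x \<in> L" and c: "c \<in> L" using assms E_sub by auto
  obtain a where a: "a \<in> tops x" using tops_nonempty[OF x] by auto
  have "leading k I (cls x) a > 0"
    using a tops_L by (subst leading_pos_iff) auto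
  moreover have "(a, c) \<in> E"
    using a tops_sub[of x] assms E_sym E_trans by blast
  ultimately have "leading k I (cls x) c > 0" using leading_eq[OF x] by metis
  then show ?thesis using leading_pos_iff[OF c] by auto
qed

text \<open>Another top element has the same weight, so it cannot dominate \<open>a\<close>; only
  the summand of \<open>a\<close> itself survives.\<close>

lemma leading_top:
  assumes "a \<in> tops x"
  shows "leading k I (cls x) a = overlap k I a a"
proof -
  have "leading k I (cls x) a = (\<Sum>b\<in>{a}. overlap k I b a)"
    unfolding leading_def
  proof (rule sum.mono_neutral_right)
    show "\<forall>b\<in>tops x - {a}. overlap k I b a = 0"
    proof
      fix b assume b: "b \<in> tops x - {a}"
      then have "\<not> (\<forall>i\<in>I. a i \<le> b i)" using tops_le_eq[OF assms, of b] tops_sub by blast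
      then have "\<not> overlap k I b a > 0" using overlap_pos_iff[OF fin] tops_L assms b by blast
      then show "overlap k I b a = 0" using overlap_nonneg[of k I b a] by linarith
    qed
  qed (use fin_tops assms in auto)
  then show ?thesis by simp
qed

lemma overlap_self: "overlap k I a a = (\<Prod>i\<in>I. 1 / fact (a i))"
  unfolding overlap_def by simp

text \<open>The hypotheses make \<open>\<rho>\<close> the distance in the graph of the class of \<open>x\<close>.\<close>

lemma graph_distance_invariant:
  fixes \<rho> :: "('i \<Rightarrow> nat) \<Rightarrow> nat"
  assumes sub: "\<And>a b c. a \<in> L \<Longrightarrow> b \<in> L \<Longrightarrow> c \<in> L \<Longrightarrow> \<forall>i\<in>I. c i \<le> a i + b i \<Longrightarrow> \<rho> c \<le> \<rho> a + \<rho> b"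
    and split: "\<And>c r. c \<in> L \<Longrightarrow> \<rho> c = Suc r \<Longrightarrow>
      \<exists>a b. a \<in> cls x \<and> b \<in> L \<and> (\<forall>i\<in>I. c i = a i + b i) \<and> \<rho> b = r"
    and one: "\<And>a. a \<in> cls x \<Longrightarrow> \<rho> a = 1"
    and zero: "\<And>c. c \<in> L \<Longrightarrow> \<rho> c = 0 \<longleftrightarrow> c = zero"
    and E: "(c, c') \<in> E"
  shows "\<rho> c = \<rho> c'"
proof -
  have le: "(c, c') \<in> E \<Longrightarrow> \<rho> c' \<le> \<rho> c" for c c'
  proof (induction "\<rho> c" arbitrary: c c')
    case 0
    then have "c = zero" using zero[of c] E_sub[OF 0(2)] by simp
    then have "c' = zero" using zero_class[of c'] 0(2) by blast
    then have "\<rho> c' = 0" by (rule iffD2[OF zero[OF conjunct2[OF E_sub[OF 0(2)]]]])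
    then show ?case by simp
  next
    case (Suc r)
    obtain a b where ab: "a \<in> cls x" "b \<in> L" "\<forall>i\<in>I. c i = a i + b i" "\<rho> b = r"
      using split[of c r] E_sub[OF Suc(3)] Suc(2) by auto
    then obtain a' b' where ab': "(a, a') \<in> E" "(b, b') \<in> E" "\<forall>i\<in>I. c' i \<le> a' i + b' i"
      using compose[OF Suc(3), of a b] cls_sub by blast
    have "\<rho> b' \<le> r" using Suc(1)[of b b'] ab ab' by auto
    moreover have "\<rho> a' = 1" using one ab ab' E_trans by blast
    moreover have "\<rho> c' \<le> \<rho> a' + \<rho> b'" using sub[OF _ _ _ ab'(3)] E_sub[OF ab'(1)] E_sub[OF ab'(2)] E_sub[OF Suc(3)] by blast
    ultimately show ?case using Suc by linarith
  qed
  show ?thesis using le[OF E] le[OF E_sym[OF E]] by simp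
qed

section \<open>The nonzero class of least top weight\<close>

definition base :: "'i \<Rightarrow> nat" where
  "base = (ARG_MIN deg x. x \<in> L \<and> x \<noteq> zero)"

lemma base: "base \<in> L" "base \<noteq> zero" "\<And>x. x \<in> L \<Longrightarrow> x \<noteq> zero \<Longrightarrow> deg base \<le> deg x"
proof -
  obtain j where j: "j \<in> I" using I_ne by auto
  have "unit_vec j \<in> L \<and> unit_vec j \<noteq> zero"
    using unit_in j zero_iff[OF unit_in] by auto
  then have "base \<in> L \<and> base \<noteq> zero \<and> (\<forall>y. y \<in> L \<and> y \<noteq> zero \<longrightarrow> deg base \<le> deg y)"
    using arg_min_nat_lemma[of "\<lambda>x. x \<in> L \<and> x \<noteq> zero" "unit_vec j" deg]
    unfolding base_def by blast
  then show "base \<in> L" "base \<noteq> zero" "\<And>x. x \<in> L \<Longrightarrow> x \<noteq> zero \<Longrightarrow> deg base \<le> deg x" by auto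
qed

lemma zero_notin_base: "zero \<notin> cls base"
  using base zero_class E_sym by blast

text \<open>Let \<open>c'\<close> be a top element of the class of \<open>c\<close>. Since
  \<open>leading\<close> for the base class is positive at \<open>c\<close>, it is positive at
  \<open>c'\<close>, so \<open>c'\<close> lies below some top element \<open>a'\<close> of the base
  class. Minimality of \<open>deg base\<close> leaves no room for a smaller weight, hence
  \<open>c' = a'\<close>.\<close>

lemma base_down_closed:
  assumes "c \<in> L" "c \<noteq> zero" "a \<in> tops base" "\<forall>i\<in>I. c i \<le> a i"
  shows "c \<in> cls base"
proof -
  obtain c' where c': "c' \<in> tops c" using tops_nonempty assms(1) by blast
  have E: "(c, c') \<in> E" using c' tops_sub by blast
  have c'L: "c' \<in> L" using E E_sub by auto
  have "leading k I (cls base) c > 0" using assms leading_pos_iff by blast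
  then have "leading k I (cls base) c' > 0" using leading_eq[OF base(1) E] by simp
  then obtain a' where a': "a' \<in> tops base" "\<forall>i\<in>I. c' i \<le> a' i"
    using leading_pos_iff[OF c'L] by blast
  have "weight I a' = deg base" "weight I c' = deg c" using a' c' weight_tops by auto
  then have "c' = a'"
    using base(3)[of c] assms a' c'L tops_L[OF a'(1)]
    by (intro weight_eq_imp_eq[OF fin]) (auto dest: L_ext)
  then show ?thesis using a' tops_sub E E_sym E_trans by blast
qed

text \<open>By \<open>cover\<close> some element of the base class is nonzero at \<open>j\<close>;
  the top element above it then dominates the unit vector, and downward closure applies.\<close>

lemma unit_in_base: "j \<in> I \<Longrightarrow> unit_vec j \<in> cls base"
proof -
  assume j: "j \<in> I"
  obtain b where b: "b \<in> cls base" "b j \<noteq> 0" using cover[OF base(1,2) j] by auto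
  obtain a where a: "a \<in> tops base" "\<forall>i\<in>I. b i \<le> a i" using below_top[OF b(1)] by auto
  have "1 \<le> a j" using a(2) j b(2) by (metis One_nat_def Suc_leI le_trans not_gr_zero)
  then have "\<forall>i\<in>I. unit_vec j i \<le> a i" by auto
  moreover have "unit_vec j \<noteq> zero" using zero_iff[OF unit_in] j by auto
  ultimately show ?thesis using base_down_closed[OF unit_in _ a(1)] by auto
qed

section \<open>Least top weight 1: equivalent vectors are permutations of each other\<close>

lemma weight_upd: "j \<in> I \<Longrightarrow> weight I (c(j := n)) + c j = weight I c + n"
  using fin unfolding weight_def by (simp add: sum.remove)

lemma weight_unit: "j \<in> I \<Longrightarrow> weight I (unit_vec j) = 1"
  using fin unfolding weight_def by simp

text \<open>The base class consists of the unit vectors, which makes the weight a graph distance and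
  hence an invariant. In the induction, removing a unit from \<open>c\<close> corresponds by
  \<open>compose\<close> to removing a unit from \<open>c'\<close>; the invariant product of
  factorials shows that both units are removed from equal entries.\<close>

lemma class_in_permutations:
  assumes deg1: "deg base = 1" and E: "(c, c') \<in> E"
  shows "image_mset c (mset_set I) = image_mset c' (mset_set I)"
proof -
  have C: "\<exists>j\<in>I. a = unit_vec j" if a: "a \<in> cls base" for a
  proof -
    have aL: "a \<in> L" and "a \<noteq> zero" using a cls_sub zero_notin_base by auto
    then obtain j where j: "j \<in> I" "a j \<noteq> 0" using zero_iff by auto
    have "weight I a \<le> 1" using weight_le_deg[OF a] deg1 by simp
    then have "unit_vec j = a"
      using j weight_unit[of j] L_ext[OF unit_in] L_ext[OF aL]
      by (intro weight_eq_imp_eq[OF fin]) auto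
    then show ?thesis using j by auto
  qed
  have weight_inv: "weight I c = weight I c'" if "(c, c') \<in> E" for c c'
  proof (rule graph_distance_invariant[where \<rho> = "weight I" and x = base, OF _ _ _ _ that])
    fix a b c :: "'i \<Rightarrow> nat" assume "\<forall>i\<in>I. c i \<le> a i + b i"
    then show "weight I c \<le> weight I a + weight I b"
      unfolding weight_def sum.distrib[symmetric] by (intro sum_mono) auto
  next
    fix c r assume c: "c \<in> L" "weight I c = Suc r"
    then obtain j where j: "j \<in> I" "c j \<noteq> 0" using weight_zero_iff[OF c(1)] zero_iff by auto
    let ?b = "c(j := c j - 1)"
    have "?b \<in> L" using c j L_le[OF c(1) j(1)] by (auto simp: PiE_def extensional_def Pi_def)
    moreover have "weight I ?b = r" using weight_upd[OF j(1), of c "c j - 1"] j c by simp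
    ultimately show "\<exists>a b. a \<in> cls base \<and> b \<in> L \<and> (\<forall>i\<in>I. c i = a i + b i) \<and> weight I b = r"
      using unit_in_base[OF j(1)] j by (intro exI[of _ "unit_vec j"] exI[of _ ?b]) auto
  next
    fix a assume "a \<in> cls base" then show "weight I a = 1" using C weight_unit by auto
  qed (rule weight_zero_iff)
  \<comment> \<open>Equal weights make every element of the class a top element, so
    \<open>leading_top\<close> turns the constancy of \<open>leading\<close> into that of the
    product of the \<open>1 / fact (c i)\<close>.\<close>
  have fact_inv: "(\<Prod>i\<in>I. fact (c i)) = (\<Prod>i\<in>I. fact (c' i) :: nat)" if E: "(c, c') \<in> E" for c c'
  proof -
    have cL: "c \<in> L" using E E_sub by auto
    have w: "weight I a = weight I c" if "a \<in> cls c" for a using weight_inv[of c a] that by simp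
    have "weight I ` cls c = (\<lambda>_. weight I c) ` cls c" by (intro image_cong refl w)
    also have "\<dots> = {weight I c}" using E_refl[OF cL] by blast
    finally have "weight I ` cls c = {weight I c}" .
    then have "c \<in> tops c" "c' \<in> tops c"
      using E E_refl[OF cL] weight_inv[OF E] unfolding top_part_def by simp_all
    then have "overlap k I c c = overlap k I c' c'"
      using leading_top[of c c] leading_top[of c' c] leading_eq[OF cL E] by simp
    then have "(\<Prod>i\<in>I. 1 / (fact (c i)::real)) = (\<Prod>i\<in>I. 1 / fact (c' i))" by (simp only: overlap_self)
    then have "(\<Prod>i\<in>I. (fact (c i)::real)) = (\<Prod>i\<in>I. fact (c' i))"
      by (simp add: prod_dividef)
    then have "real (\<Prod>i\<in>I. fact (c i)) = real (\<Prod>i\<in>I. fact (c' i))" by simp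
    then show ?thesis using of_nat_eq_iff by blast
  qed
  have split_mset: "image_mset c (mset_set I) = add_mset (c j) (image_mset c (mset_set (I - {j})))"
    if "j \<in> I" for c :: "'i \<Rightarrow> nat" and j
    using fin that by (simp add: mset_set.remove)
  show ?thesis using E
  proof (induction "weight I c" arbitrary: c c')
    case 0
    then have "c = zero" using weight_zero_iff[of c] E_sub[OF 0(2)] by simp
    moreover then have "c' = zero" using zero_class[of c'] 0(2) by blast
    ultimately show ?case by simp
  next
    case (Suc n)
    have cL: "c \<in> L" "c' \<in> L" using Suc(3) E_sub by auto
    then obtain j where j: "j \<in> I" "c j \<noteq> 0"
      using weight_zero_iff[OF cL(1)] zero_iff Suc(2) by auto
    define b where "b = c(j := c j - 1)"
    have bL: "b \<in> L" unfolding b_def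
      using cL j L_le[OF cL(1) j(1)] by (auto simp: PiE_def extensional_def Pi_def)
    have wb: "weight I b = n" unfolding b_def using weight_upd[OF j(1), of c "c j - 1"] j Suc(2) by simp
    obtain a' b' where ab': "(unit_vec j, a') \<in> E" "(b, b') \<in> E" "\<forall>i\<in>I. c' i \<le> a' i + b' i"
      using compose[OF Suc(3) unit_in bL] j unfolding b_def by fastforce
    have "a' \<in> cls base" using ab'(1) unit_in_base[OF j(1)] E_trans by blast
    then obtain j' where j': "j' \<in> I" "a' = unit_vec j'" using C by auto
    define c'' where "c'' = b'(j' := Suc (b' j'))"
    have b'L: "b' \<in> L" using ab' E_sub by auto
    have wb': "weight I b' = n" using weight_inv ab'(2) wb by auto
    \<comment> \<open>\<open>c'\<close> lies below \<open>b'\<close> plus a unit vector, and both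
      have the same weight.\<close>
    have "c' = c''"
    proof (rule weight_eq_imp_eq[OF fin])
      show "c' i \<le> c'' i" if "i \<in> I" for i
        using ab'(3) j' that unfolding c''_def by (auto split: if_splits)
      show "weight I c'' \<le> weight I c'"
        using weight_upd[OF j'(1), of b' "Suc (b' j')"] wb' weight_inv[OF Suc(3)] Suc(2)
        unfolding c''_def by simp
      show "c' \<in> extensional I" "c'' \<in> extensional I"
        using cL b'L j'(1) unfolding c''_def by (auto simp: PiE_def extensional_def)
    qed
    have mb: "image_mset b (mset_set I) = image_mset b' (mset_set I)"
      using Suc(1)[OF _ ab'(2)] wb by simp
    \<comment> \<open>By induction \<open>b\<close> and \<open>b'\<close> have the same factorial
      product. Putting the units back multiplies it by \<open>Suc (b j)\<close> and
      \<open>Suc (b' j')\<close>, so the invariance of the product equates these two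
      factors.\<close>
    have "prod_mset (image_mset fact (image_mset b (mset_set I)))
        = (prod_mset (image_mset fact (image_mset b' (mset_set I))) :: nat)"
      using mb by simp
    then have fb: "(\<Prod>i\<in>I. fact (b i)) = (\<Prod>i\<in>I. fact (b' i) :: nat)"
      by (simp add: prod_unfold_prod_mset image_mset.compositionality comp_def)
    have fstep: "(\<Prod>i\<in>I. fact ((x(l := Suc (x l))) i)) = Suc (x l) * (\<Prod>i\<in>I. fact (x i) :: nat)"
      if "l \<in> I" for x :: "'i \<Rightarrow> nat" and l
      using fin that by (simp add: prod.remove[of I l] algebra_simps)
    have cb: "c = b(j := Suc (b j))" using j unfolding b_def by auto
    have "Suc (b j) * (\<Prod>i\<in>I. fact (b i) :: nat) = Suc (b' j') * (\<Prod>i\<in>I. fact (b' i) :: nat)"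
      using fact_inv[OF Suc(3)] fstep[OF j(1), of b] fstep[OF j'(1), of b']
      unfolding \<open>c' = c''\<close> c''_def cb by metis
    moreover have "(\<Prod>i\<in>I. fact (b' i) :: nat) \<noteq> 0" using fin by simp
    ultimately have eq: "b j = b' j'" using fb by simp
    have mstep: "image_mset (x(l := y)) (mset_set (I - {l})) = image_mset x (mset_set (I - {l}))"
      for x :: "'i \<Rightarrow> nat" and l y
      using fin by (intro image_mset_cong) auto
    have "image_mset b (mset_set (I - {j})) = image_mset b' (mset_set (I - {j'}))"
      using mb split_mset[OF j(1), of b] split_mset[OF j'(1), of b'] eq by simp
    then show ?case
      unfolding \<open>c' = c''\<close> c''_def cb split_mset[OF j(1), of "b(j := _)"]
        split_mset[OF j'(1), of "b'(j' := _)"] mstep using eq by simp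
  qed
qed

section \<open>Least top weight at least 2: blocks of coordinates\<close>

abbreviation "full_vec B \<equiv> (\<lambda>i\<in>I. if i \<in> B then k else 0)"

lemma full_in: "full_vec B \<in> L" by auto

definition blocks :: "'i set set" where "blocks = supp_on I ` tops base"

text \<open>Lowering \<open>a\<close> by one at \<open>j\<close> gives a vector \<open>c\<close>
  that is still nonzero because \<open>deg base\<close> is not 1, hence \<open>c\<close> is in the
  base class. The summand of \<open>a\<close> in \<open>leading\<close> grows by the factor
  \<open>Suc (k - a j)\<close> from \<open>a\<close> to \<open>c\<close>, while at \<open>a\<close>
  it is the whole sum. Constancy of \<open>leading\<close> forces this factor to be 1.\<close>

lemma top_full:
  assumes deg: "deg base \<noteq> 1" and a: "a \<in> tops base" and j: "j \<in> I" "a j \<noteq> 0"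
  shows "a j = k"
proof -
  define c where "c = a(j := a j - 1)"
  have aL: "a \<in> L" using a tops_L by auto
  have cL: "c \<in> L" unfolding c_def
    using aL j L_le[OF aL j(1)] by (auto simp: PiE_def extensional_def Pi_def)
  have "weight I c + 1 = deg base"
    using fin j weight_tops[OF a] unfolding c_def weight_def by (simp add: sum.remove)
  then have "c \<noteq> zero" using deg weight_zero_iff[OF cL] by auto
  moreover have le: "\<forall>i\<in>I. c i \<le> a i" unfolding c_def by auto
  ultimately have "c \<in> cls base" using base_down_closed[OF cL _ a] by auto
  moreover have "a \<in> cls base" using a tops_sub by blast
  ultimately have "(c, a) \<in> E" using E_sym E_trans by blast
  then have "leading k I (cls base) c = overlap k I a a"
    using leading_eq[OF base(1)] leading_top[OF a] by simp
  moreover have "overlap k I a c \<le> leading k I (cls base) c"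
    unfolding leading_def using fin_tops overlap_nonneg a by (intro member_le_sum) auto
  ultimately have "overlap k I a c \<le> overlap k I a a" by simp
  moreover have "overlap k I a c = real (Suc (k - a j)) * overlap k I a a"
  proof -
    have "k - c j = Suc (k - a j)" using j L_le[OF aL j(1)] unfolding c_def by auto
    then have 1: "real (k - c j choose (k - a j)) = real (Suc (k - a j))" by simp
    have 2: "(\<Prod>i\<in>I - {j}. real (k - c i choose (k - a i)) / fact (a i))
      = (\<Prod>i\<in>I - {j}. real (k - a i choose (k - a i)) / fact (a i))"
      unfolding c_def by (intro prod.cong) auto
    show ?thesis
      unfolding overlap_def prod.remove[OF fin j(1)] 1 2 by simp
  qed
  moreover have "overlap k I a a > 0" using overlap_pos_iff[OF fin aL aL] by simp
  ultimately have "real (Suc (k - a j)) \<le> 1" by simp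
  then show ?thesis using L_le[OF aL j(1)] by simp
qed

lemma weight_full:
  assumes "a \<in> L" "\<forall>i\<in>I. a i = 0 \<or> a i = k"
  shows "weight I a = k * card (supp_on I a)"
proof -
  have "weight I a = (\<Sum>i\<in>I. if a i \<noteq> 0 then k else 0)"
    unfolding weight_def using assms(2) by (intro sum.cong) auto
  also have "\<dots> = (\<Sum>i\<in>supp_on I a. k)"
    unfolding supp_on_def using fin by (simp add: sum.inter_filter[symmetric])
  finally show ?thesis by simp
qed

lemma full_eq:
  assumes "a \<in> L" "\<forall>i\<in>I. a i = 0 \<or> a i = k"
  shows "a = full_vec (supp_on I a)"
  by (rule extensionalityI[of _ I]) (use assms k_pos in \<open>auto simp: supp_on_def PiE_def\<close>)

context
  assumes deg: "deg base \<noteq> 1"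
begin

lemma tops_full: "a \<in> tops base \<Longrightarrow> \<forall>i\<in>I. a i = 0 \<or> a i = k"
  using top_full[OF deg] by blast

text \<open>A top element equals \<open>k\<close> on its support, so \<open>deg base\<close> is
  \<open>k\<close> times the size of the support and the division is exact.\<close>

definition "block_size = deg base div k"

lemma card_supp_tops: "a \<in> tops base \<Longrightarrow> card (supp_on I a) = block_size"
  using weight_full[OF tops_L tops_full] weight_tops k_pos unfolding block_size_def by simp

lemma block_size_pos: "block_size > 0"
proof -
  obtain a where a: "a \<in> tops base" using tops_nonempty base by blast
  then have "a \<noteq> zero" using tops_sub zero_notin_base by blast
  then have "supp_on I a \<noteq> {}" using zero_iff[OF tops_L[OF a]] unfolding supp_on_def by auto
  moreover have "finite (supp_on I a)" using fin unfolding supp_on_def by simp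
  ultimately show ?thesis using card_supp_tops[OF a] by (metis card_gt_0_iff)
qed

text \<open>All top elements take only the values 0 and \<open>k\<close> and have supports of equal
  size, so every positive overlap has the same value and \<open>leading\<close> merely counts the
  top elements above \<open>c\<close>.\<close>

lemma leading_base:
  assumes c: "c \<in> L"
  shows "leading k I (cls base) c = (1 / fact k) ^ block_size * real (card {a \<in> tops base. \<forall>i\<in>I. c i \<le> a i})"
proof -
  have "leading k I (cls base) c = (\<Sum>a\<in>tops base. if \<forall>i\<in>I. c i \<le> a i then (1 / fact k) ^ block_size else 0)"
    unfolding leading_def
  proof (intro sum.cong refl)
    fix a assume a: "a \<in> tops base"
    have "overlap k I a c = 0" if "\<not> (\<forall>i\<in>I. c i \<le> a i)"
      using overlap_pos_iff[OF fin tops_L[OF a] c] that overlap_nonneg[of k I a c] by linarith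
    then show "overlap k I a c = (if \<forall>i\<in>I. c i \<le> a i then (1 / fact k) ^ block_size else 0)"
      using overlap_full[OF fin tops_full[OF a], of c] card_supp_tops[OF a] by simp
  qed
  also have "\<dots> = (\<Sum>a\<in>{a \<in> tops base. \<forall>i\<in>I. c i \<le> a i}. (1 / fact k) ^ block_size)"
    using fin_tops by (simp only: sum.inter_filter)
  finally show ?thesis by simp
qed

text \<open>The only top element above a top element is itself. Constancy of the count from
  \<open>leading_base\<close> carries this over to the unit vector at \<open>j\<close>, so exactly
  one top element is nonzero there.\<close>

lemma ex1_top: "j \<in> I \<Longrightarrow> \<exists>a\<in>tops base. {b \<in> tops base. b j \<noteq> 0} = {a}"
proof -
  assume j: "j \<in> I"
  obtain a where a: "a \<in> tops base" using tops_nonempty base by blast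
  then have E: "(unit_vec j, a) \<in> E"
    using unit_in_base[OF j] tops_sub[of base] E_sym E_trans by blast
  have "{b \<in> tops base. \<forall>i\<in>I. a i \<le> b i} = {a}"
    using tops_le_eq[OF a] tops_sub[of base] a by auto
  then have "card {b \<in> tops base. \<forall>i\<in>I. unit_vec j i \<le> b i} = 1"
    using leading_eq[OF base(1) E] leading_base[OF unit_in, of j] leading_base[OF tops_L[OF a]]
    by simp
  moreover have "(\<forall>i\<in>I. unit_vec j i \<le> b i) \<longleftrightarrow> b j \<noteq> 0" for b :: "'i \<Rightarrow> nat" using j by auto
  ultimately have "card {b \<in> tops base. b j \<noteq> 0} = 1" by simp
  then obtain b where b: "{b \<in> tops base. b j \<noteq> 0} = {b}" by (rule card_1_singletonE)
  then have "b \<in> tops base" by blast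
  with b show ?thesis by blast
qed

lemma partition_blocks: "partition_on I blocks"
proof (rule partition_onI)
  show "\<Union>blocks = I"
  proof
    show "\<Union>blocks \<subseteq> I" unfolding blocks_def supp_on_def by auto
    show "I \<subseteq> \<Union>blocks"
    proof
      fix j assume j: "j \<in> I"
      obtain a where a: "a \<in> tops base" "{b \<in> tops base. b j \<noteq> 0} = {a}"
        using ex1_top[OF j] by blast
      then have "a j \<noteq> 0" by blast
      then have "j \<in> supp_on I a" using j unfolding supp_on_def by simp
      then show "j \<in> \<Union>blocks" using a(1) unfolding blocks_def by blast
    qed
  qed
next
  have "card p = block_size" if "p \<in> blocks" for p using card_supp_tops that unfolding blocks_def by blast
  then show "{} \<notin> blocks" using block_size_pos by fastforce
next
  fix p q assume pq: "p \<in> blocks" "q \<in> blocks" "p \<noteq> q"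
  obtain a b where ab: "a \<in> tops base" "p = supp_on I a" "b \<in> tops base" "q = supp_on I b"
    using pq(1,2) unfolding blocks_def by blast
  show "disjnt p q"
  proof (rule ccontr)
    assume "\<not> disjnt p q"
    then obtain j where j: "j \<in> p" "j \<in> q" by (auto simp: disjnt_def)
    then have "a \<in> {b \<in> tops base. b j \<noteq> 0}" "b \<in> {b \<in> tops base. b j \<noteq> 0}" "j \<in> I"
      using ab unfolding supp_on_def by auto
    then have "a = b" using ex1_top[of j] by (metis (no_types, lifting) singletonD)
    then show False using ab pq by simp
  qed
qed

lemma card_block: "B \<in> blocks \<Longrightarrow> card B = block_size"
  using card_supp_tops unfolding blocks_def by auto

lemma block_sub: "B \<in> blocks \<Longrightarrow> B \<subseteq> I" unfolding blocks_def supp_on_def by auto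

lemma full_block_top: "B \<in> blocks \<Longrightarrow> full_vec B \<in> tops base"
  using full_eq[OF tops_L tops_full] unfolding blocks_def by auto

lemma finite_blocks: "finite blocks" unfolding blocks_def using fin_tops by simp

lemma block_unique: "B \<in> blocks \<Longrightarrow> B' \<in> blocks \<Longrightarrow> i \<in> B \<Longrightarrow> i \<in> B' \<Longrightarrow> B = B'"
  using partition_onD2[OF partition_blocks] unfolding disjoint_def by blast

lemma block_ex: "i \<in> I \<Longrightarrow> \<exists>B\<in>blocks. i \<in> B"
  using partition_onD1[OF partition_blocks] by auto

text \<open>Every element of the class lies below a top element, whose support is one block.
  Conversely a vector that meets only \<open>B\<close> lies below the full vector of
  \<open>B\<close>, and downward closure applies.\<close>

lemma in_base_iff:
  assumes c: "c \<in> L"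
  shows "c \<in> cls base \<longleftrightarrow> (\<exists>B. touched blocks c = {B})"
proof
  assume "c \<in> cls base"
  then obtain a where a: "a \<in> tops base" "\<forall>i\<in>I. c i \<le> a i" using below_top by blast
  have "c \<noteq> zero" using \<open>c \<in> cls base\<close> zero_notin_base by blast
  then obtain j where j: "j \<in> I" "c j \<noteq> 0" using zero_iff[OF c] by auto
  have supp: "i \<in> supp_on I a" if "i \<in> I" "c i \<noteq> 0" for i
    using a(2) that unfolding supp_on_def by force
  have B: "supp_on I a \<in> blocks" using a(1) unfolding blocks_def by auto
  have "touched blocks c = {supp_on I a}"
  proof (intro equalityI subsetI)
    fix B assume "B \<in> touched blocks c"
    then obtain i where i: "B \<in> blocks" "i \<in> B" "c i \<noteq> 0" unfolding touched_def by auto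
    then have "i \<in> I" using block_sub by auto
    then show "B \<in> {supp_on I a}" using block_unique[OF i(1) B i(2)] supp i by auto
  qed (use B j supp in \<open>auto simp: touched_def\<close>)
  then show "\<exists>B. touched blocks c = {B}" by blast
next
  assume "\<exists>B. touched blocks c = {B}"
  then obtain B where B: "touched blocks c = {B}" by auto
  then have BP: "B \<in> blocks" and ex: "\<exists>i\<in>B. c i \<noteq> 0" unfolding touched_def by auto
  have "i \<in> B" if i: "i \<in> I" "c i \<noteq> 0" for i
  proof -
    obtain B' where B': "B' \<in> blocks" "i \<in> B'" using block_ex i by auto
    then have "B' \<in> touched blocks c" using i unfolding touched_def by auto
    then show ?thesis using B B' by auto
  qed
  then have "\<forall>i\<in>I. c i \<le> full_vec B i" using L_le[OF c] by force
  moreover have "\<not> (\<forall>i\<in>I. c i = 0)" using ex block_sub[OF BP] by auto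
  then have "c \<noteq> zero" by (rule contrapos_nn) (rule iffD1[OF zero_iff[OF c]])
  ultimately show "c \<in> cls base" using base_down_closed[OF c _ full_block_top[OF BP]] by blast
qed

lemma touched_empty_iff:
  assumes "c \<in> L"
  shows "touched blocks c = {} \<longleftrightarrow> c = zero"
proof -
  have "touched blocks c = {} \<longleftrightarrow> (\<forall>i\<in>\<Union>blocks. c i = 0)" unfolding touched_def by auto
  also have "\<dots> \<longleftrightarrow> c = zero"
    using zero_iff[OF assms] partition_onD1[OF partition_blocks] by simp
  finally show ?thesis .
qed

lemma fin_touched: "finite (touched blocks c)" unfolding touched_def using finite_blocks by simp

text \<open>The number of blocks met is subadditive, and it is 1 on the base class. Cutting
  \<open>c\<close> into its part \<open>a\<close> inside one touched block and the rest
  \<open>b\<close> splits off an element of the base class, so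
  \<open>graph_distance_invariant\<close> applies.\<close>

lemma card_touched_invariant:
  assumes E: "(c, c') \<in> E"
  shows "card (touched blocks c) = card (touched blocks c')"
proof (rule graph_distance_invariant[where \<rho> = "\<lambda>c. card (touched blocks c)" and x = base, OF _ _ _ _ E])
  fix a b c :: "'i \<Rightarrow> nat" assume le: "\<forall>i\<in>I. c i \<le> a i + b i"
  have "touched blocks c \<subseteq> touched blocks a \<union> touched blocks b"
  proof
    fix B assume "B \<in> touched blocks c"
    then obtain i where i: "B \<in> blocks" "i \<in> B" "c i \<noteq> 0" unfolding touched_def by auto
    then have "a i \<noteq> 0 \<or> b i \<noteq> 0" using le block_sub by fastforce
    then show "B \<in> touched blocks a \<union> touched blocks b" using i unfolding touched_def by auto
  qed
  then have "card (touched blocks c) \<le> card (touched blocks a \<union> touched blocks b)"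
    using fin_touched by (intro card_mono) auto
  also have "\<dots> \<le> card (touched blocks a) + card (touched blocks b)" by (rule card_Un_le)
  finally show "card (touched blocks c) \<le> card (touched blocks a) + card (touched blocks b)" .
next
  fix c r assume c: "c \<in> L" "card (touched blocks c) = Suc r"
  then obtain B where B: "B \<in> touched blocks c" by fastforce
  then have BP: "B \<in> blocks" unfolding touched_def by auto
  define a where "a = (\<lambda>i\<in>I. if i \<in> B then c i else 0)"
  define b where "b = (\<lambda>i\<in>I. if i \<in> B then 0 else c i)"
  have aL: "a \<in> L" and bL: "b \<in> L" unfolding a_def b_def using c(1) by auto
  have "touched blocks a = {B}"
  proof (intro equalityI subsetI)
    fix B' assume "B' \<in> touched blocks a"
    then obtain i where i: "B' \<in> blocks" "i \<in> B'" "a i \<noteq> 0" unfolding touched_def by auto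
    then have "i \<in> B" using block_sub unfolding a_def by (auto split: if_splits)
    then show "B' \<in> {B}" using block_unique[OF i(1) BP i(2)] by auto
  next
    fix B' assume "B' \<in> {B}"
    then show "B' \<in> touched blocks a" using B block_sub[OF BP] unfolding touched_def a_def by auto
  qed
  then have "a \<in> cls base" using in_base_iff[OF aL] by blast
  moreover have "touched blocks b = touched blocks c - {B}"
  proof (intro equalityI subsetI)
    fix B' assume "B' \<in> touched blocks b"
    then obtain i where i: "B' \<in> blocks" "i \<in> B'" "b i \<noteq> 0" unfolding touched_def by auto
    then have "i \<notin> B" "c i \<noteq> 0" using block_sub unfolding b_def by (auto split: if_splits)
    then show "B' \<in> touched blocks c - {B}" using i unfolding touched_def by auto
  next
    fix B' assume B': "B' \<in> touched blocks c - {B}"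
    then obtain i where i: "B' \<in> blocks" "i \<in> B'" "c i \<noteq> 0" unfolding touched_def by auto
    then have "i \<notin> B" using block_unique[OF i(1) BP i(2)] B' by auto
    then have "b i \<noteq> 0" using i block_sub[OF i(1)] unfolding b_def by auto
    then show "B' \<in> touched blocks b" using i unfolding touched_def by auto
  qed
  then have "card (touched blocks b) = r" using c B fin_touched by simp
  moreover have "\<forall>i\<in>I. c i = a i + b i" unfolding a_def b_def by auto
  ultimately show "\<exists>a b. a \<in> cls base \<and> b \<in> L \<and> (\<forall>i\<in>I. c i = a i + b i) \<and> card (touched blocks b) = r"
    using bL by blast
next
  fix a assume a: "a \<in> cls base"
  then have "\<exists>B. touched blocks a = {B}" using in_base_iff cls_sub by blast
  then show "card (touched blocks a) = 1" by auto
next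
  fix c assume "c \<in> L"
  then show "(card (touched blocks c) = 0) = (c = zero)"
    using touched_empty_iff fin_touched by auto
qed

text \<open>The unit vector at a point of \<open>B\<close> and the full vector of \<open>B\<close>
  both lie in the base class, so \<open>leading\<close> for the class of \<open>x\<close> agrees at
  them. By antitonicity no summand grows from the former to the latter, so every summand is
  unchanged. That of \<open>b\<close> is positive at the unit vector, hence also at the full
  block.\<close>

lemma top_contains_block:
  assumes x: "x \<in> L" and b: "b \<in> tops x" and B: "B \<in> touched blocks b" and i: "i \<in> B"
  shows "b i = k"
proof -
  obtain j where j: "B \<in> blocks" "j \<in> B" "b j \<noteq> 0" using B unfolding touched_def by auto
  have BI: "B \<subseteq> I" using block_sub j by auto
  then have jI: "j \<in> I" using j by auto
  have bL: "b \<in> L" using b tops_L by auto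
  have E: "(unit_vec j, full_vec B) \<in> E"
    using unit_in_base[OF jI] full_block_top[OF j(1)] tops_sub[of base] E_sym E_trans by blast
  have le: "overlap k I a (full_vec B) \<le> overlap k I a (unit_vec j)" for a
    using k_pos j by (intro overlap_antimono) auto
  have "(\<Sum>a\<in>tops x. overlap k I a (unit_vec j) - overlap k I a (full_vec B)) = 0"
    using leading_eq[OF x E] unfolding leading_def sum_subtractf by simp
  then have "overlap k I b (unit_vec j) - overlap k I b (full_vec B) = 0"
    using sum_nonneg_eq_0_iff[OF fin_tops[of x], of "\<lambda>a. overlap k I a (unit_vec j) - overlap k I a (full_vec B)"]
      le b by simp
  moreover have "overlap k I b (unit_vec j) > 0"
    using overlap_pos_iff[OF fin bL unit_in] j by auto
  ultimately have "overlap k I b (full_vec B) > 0" by simp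
  then have "full_vec B i \<le> b i"
    using overlap_pos_iff[OF fin bL full_in] i BI by blast
  then show "b i = k" using i BI L_le[OF bL, of i] by force
qed

text \<open>A top element \<open>b\<close> above \<open>c\<close> meets all blocks that
  \<open>c\<close> meets, and equally many blocks, hence the same ones; on these it is full by
  \<open>top_contains_block\<close>.\<close>

lemma class_full:
  assumes c: "c \<in> L"
  shows "(c, full_vec (\<Union>(touched blocks c))) \<in> E"
proof -
  obtain b where b: "b \<in> tops c" "\<forall>i\<in>I. c i \<le> b i" using below_top[of c c] E_refl[OF c] by auto
  have bL: "b \<in> L" using b tops_L by auto
  have E: "(c, b) \<in> E" using b tops_sub by blast
  have "touched blocks c \<subseteq> touched blocks b"
  proof
    fix B assume "B \<in> touched blocks c"
    then obtain i where i: "B \<in> blocks" "i \<in> B" "c i \<noteq> 0" unfolding touched_def by auto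
    then have "c i \<le> b i" using b(2) block_sub by blast
    then have "b i \<noteq> 0" using i(3) by simp
    then show "B \<in> touched blocks b" using i(1,2) unfolding touched_def by blast
  qed
  then have eq: "touched blocks c = touched blocks b"
    using card_subset_eq[OF fin_touched] card_touched_invariant[OF E] by blast
  have "b = full_vec (\<Union>(touched blocks c))"
  proof (rule extensionalityI[of _ I])
    fix i assume i: "i \<in> I"
    then obtain B where B: "B \<in> blocks" "i \<in> B" using block_ex by auto
    show "b i = full_vec (\<Union>(touched blocks c)) i"
    proof (cases "B \<in> touched blocks b")
      case True
      then show ?thesis using top_contains_block[OF c b(1) True B(2)] i B eq by auto
    next
      case False
      then have "b i = 0" using B unfolding touched_def by auto
      have "i \<notin> B'" if B': "B' \<in> touched blocks b" for B'
      proof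
        assume "i \<in> B'"
        then have "B' = B" using block_unique[of B' B i] B B' unfolding touched_def by blast
        then show False using False B' by simp
      qed
      then have "i \<notin> \<Union>(touched blocks c)" unfolding eq by blast
      with \<open>b i = 0\<close> show ?thesis using i by simp
    qed
  qed (use bL in \<open>auto simp: PiE_def\<close>)
  then show ?thesis using E by simp
qed

lemma touched_eq_imp_class_eq:
  assumes "c \<in> L" "c' \<in> L" "touched blocks c = touched blocks c'"
  shows "(c, c') \<in> E"
  using E_trans[OF class_full[OF assms(1), unfolded assms(3)] E_sym[OF class_full[OF assms(2)]]] .

end

theorem cameron_or_hamming: "cameron_type I E \<or> (\<exists>e>0. \<exists>P. hamming_type I k E e P)"
proof (cases "deg base = 1")
  case True
  then have "cameron_type I E" unfolding cameron_type_def by (auto intro: class_in_permutations)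
  then show ?thesis ..
next
  case False
  have "hamming_type I k E block_size blocks"
    unfolding hamming_type_def
    by (auto intro: partition_blocks[OF False] card_block[OF False] touched_eq_imp_class_eq[OF False]
        card_touched_invariant[OF False])
  then show ?thesis using block_size_pos[OF False] by blast
qed

end

section \<open>The schemes as fibre partitions\<close>

text \<open>Only values attained on \<open>A\<close> produce a class, which matches the removal of
  the empty relation from the schemes. Refinement then becomes a comparison of function
  values.\<close>

definition fibres :: "'a set \<Rightarrow> ('a \<Rightarrow> 'b) \<Rightarrow> 'a set set" where
  "fibres A f = (\<lambda>p. {q \<in> A. f q = f p}) ` A"

lemma partition_on_fibres: "partition_on A (fibres A f)"
  by (rule partition_onI) (auto simp: fibres_def disjnt_def)

lemma fibres_eqI:
  assumes "\<And>X. X \<in> Q \<Longrightarrow> X \<noteq> {}" "\<And>X. X \<in> Q \<Longrightarrow> X \<subseteq> A"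
    and "\<And>p. p \<in> A \<Longrightarrow> \<exists>X\<in>Q. p \<in> X"
    and "\<And>X p q. X \<in> Q \<Longrightarrow> p \<in> X \<Longrightarrow> q \<in> A \<Longrightarrow> q \<in> X \<longleftrightarrow> f q = f p"
  shows "Q = fibres A f"
proof -
  have X: "X = {q \<in> A. f q = f p}" if "X \<in> Q" "p \<in> X" for X p
    using assms(2,4)[OF that(1)] that(2) by blast
  show ?thesis
  proof (intro equalityI subsetI)
    fix X assume "X \<in> Q"
    then obtain p where "p \<in> X" "p \<in> A" using assms(1,2) by blast
    then show "X \<in> fibres A f" using X[OF \<open>X \<in> Q\<close>] unfolding fibres_def by blast
  next
    fix X assume "X \<in> fibres A f"
    then obtain p where p: "p \<in> A" "X = {q \<in> A. f q = f p}" unfolding fibres_def by blast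
    then obtain Y where "Y \<in> Q" "p \<in> Y" using assms(3) by blast
    then show "X \<in> Q" using X p by simp
  qed
qed

lemma refines_fibresI:
  assumes "partition_on A Q" "\<And>X p q. X \<in> Q \<Longrightarrow> p \<in> X \<Longrightarrow> q \<in> X \<Longrightarrow> f p = f q"
  shows "refines A Q (fibres A f)"
  unfolding refines_def
proof (intro conjI ballI partition_on_fibres assms(1))
  fix X assume X: "X \<in> Q"
  then have "X \<noteq> {}" using partition_onD3[OF assms(1)] by blast
  then obtain p where p: "p \<in> X" by blast
  have "X \<subseteq> A" using X partition_onD1[OF assms(1)] by blast
  then have "X \<subseteq> {q \<in> A. f q = f p}" "p \<in> A" using assms(2)[OF X _ p] p by blast+
  then show "\<exists>Y\<in>fibres A f. X \<subseteq> Y" unfolding fibres_def by blast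
qed

lemma fibres_refinesI:
  assumes "partition_on A Q" "\<And>X p q. X \<in> Q \<Longrightarrow> p \<in> X \<Longrightarrow> q \<in> A \<Longrightarrow> f q = f p \<Longrightarrow> q \<in> X"
  shows "refines A (fibres A f) Q"
  unfolding refines_def
proof (intro conjI ballI partition_on_fibres assms(1))
  fix Y assume "Y \<in> fibres A f"
  then obtain p where p: "p \<in> A" "Y = {q \<in> A. f q = f p}" unfolding fibres_def by blast
  then obtain X where X: "X \<in> Q" "p \<in> X" using partition_onD1[OF assms(1)] by blast
  then show "\<exists>X\<in>Q. Y \<subseteq> X" using assms(2)[OF X] p(2) by blast
qed

lemma tensor_rel_nonempty:
  assumes "\<And>i. i \<in> I \<Longrightarrow> a i \<noteq> {}" "\<And>i. i \<in> I \<Longrightarrow> a i \<subseteq> V \<times> V"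
  shows "tensor_rel I V a \<noteq> {}"
proof -
  have "\<forall>i\<in>I. \<exists>p. p \<in> a i" using assms(1) by blast
  then obtain p where p: "\<forall>i\<in>I. p i \<in> a i" by metis
  then have "fst (p i) \<in> V" "snd (p i) \<in> V" if "i \<in> I" for i
    using assms(2)[OF that] that by auto
  then have "((\<lambda>i\<in>I. fst (p i)), (\<lambda>i\<in>I. snd (p i))) \<in> tensor_rel I V a"
    using p unfolding tensor_rel_def by auto
  then show ?thesis by blast
qed

lemma hamming_scheme_fibres:
  assumes "finite P"
  shows "hamming_scheme P A = fibres ((P \<rightarrow>\<^sub>E A) \<times> (P \<rightarrow>\<^sub>E A)) (\<lambda>(x, y). card {i \<in> P. x i \<noteq> y i})"
proof (rule fibres_eqI)
  fix p assume "p \<in> (P \<rightarrow>\<^sub>E A) \<times> (P \<rightarrow>\<^sub>E A)"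
  then obtain x y where p: "p = (x, y)" "x \<in> P \<rightarrow>\<^sub>E A" "y \<in> P \<rightarrow>\<^sub>E A" by blast
  let ?j = "card {i \<in> P. x i \<noteq> y i}"
  let ?X = "{(x, y). x \<in> P \<rightarrow>\<^sub>E A \<and> y \<in> P \<rightarrow>\<^sub>E A \<and> card {i \<in> P. x i \<noteq> y i} = ?j}"
  have "?j \<le> card P" using assms by (intro card_mono) auto
  moreover have pX: "p \<in> ?X" using p by simp
  ultimately have "?X \<in> hamming_scheme P A" unfolding hamming_scheme_def
    by (intro DiffI image_eqI[of _ _ ?j]) auto
  with pX show "\<exists>X\<in>hamming_scheme P A. p \<in> X" by (rule bexI)
qed (auto simp: hamming_scheme_def)

lemma trivial_power_fibres:
  "tensor_power P A (trivial_scheme A) =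
     fibres ((P \<rightarrow>\<^sub>E A) \<times> (P \<rightarrow>\<^sub>E A)) (\<lambda>(x, y). {i \<in> P. x i \<noteq> y i})"
proof (rule fibres_eqI)
  have sub: "R \<noteq> {}" "R \<subseteq> A \<times> A" if "R \<in> trivial_scheme A" for R
    using that unfolding trivial_scheme_def by auto
  fix X assume "X \<in> tensor_power P A (trivial_scheme A)"
  then obtain a where a: "a \<in> P \<rightarrow>\<^sub>E trivial_scheme A" "X = tensor_rel P A a"
    unfolding tensor_power_def by blast
  then have "a i \<in> trivial_scheme A" if "i \<in> P" for i using that by blast
  then show "X \<noteq> {}" unfolding a(2) using sub by (intro tensor_rel_nonempty) blast+
  show "X \<subseteq> (P \<rightarrow>\<^sub>E A) \<times> (P \<rightarrow>\<^sub>E A)" using a(2) unfolding tensor_rel_def by blast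
  fix p q assume p: "p \<in> X" and q: "q \<in> (P \<rightarrow>\<^sub>E A) \<times> (P \<rightarrow>\<^sub>E A)"
  obtain x y where xy: "p = (x, y)" "x \<in> P \<rightarrow>\<^sub>E A" "y \<in> P \<rightarrow>\<^sub>E A" "\<forall>i\<in>P. (x i, y i) \<in> a i"
    using p a(2) unfolding tensor_rel_def by blast
  obtain x' y' where xy': "q = (x', y')" "x' \<in> P \<rightarrow>\<^sub>E A" "y' \<in> P \<rightarrow>\<^sub>E A" using q by blast
  have key: "(x' i, y' i) \<in> a i \<longleftrightarrow> (x' i \<noteq> y' i \<longleftrightarrow> x i \<noteq> y i)" if i: "i \<in> P" for i
  proof -
    have A: "x' i \<in> A" "y' i \<in> A" using xy'(2,3) i by (auto simp: PiE_iff)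
    have xyi: "(x i, y i) \<in> a i" using xy(4) i by blast
    have "a i \<in> trivial_scheme A" using a(1) i by (rule PiE_mem)
    then consider "a i = Id_on A" | "a i = A \<times> A - Id_on A" unfolding trivial_scheme_def by blast
    then show ?thesis
    proof cases
      case 1
      then show ?thesis using A xyi by (simp add: Id_on_iff)
    next
      case 2
      have "x i \<noteq> y i" using xyi[unfolded 2] by (metis DiffE Id_onI mem_Sigma_iff)
      then show ?thesis using 2 A by (simp add: Id_on_iff)
    qed
  qed
  have "q \<in> X \<longleftrightarrow> (\<forall>i\<in>P. (x' i, y' i) \<in> a i)"
    using xy' a(2) unfolding tensor_rel_def by simp
  also have "\<dots> \<longleftrightarrow> (\<forall>i\<in>P. x' i \<noteq> y' i \<longleftrightarrow> x i \<noteq> y i)"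
    using key by (intro ball_cong refl)
  also have "\<dots> \<longleftrightarrow> {i \<in> P. x' i \<noteq> y' i} = {i \<in> P. x i \<noteq> y i}" by blast
  finally show "q \<in> X \<longleftrightarrow> (\<lambda>(x, y). {i \<in> P. x i \<noteq> y i}) q = (\<lambda>(x, y). {i \<in> P. x i \<noteq> y i}) p"
    using xy(1) xy'(1) by simp
next
  fix p assume "p \<in> (P \<rightarrow>\<^sub>E A) \<times> (P \<rightarrow>\<^sub>E A)"
  then obtain x y where p: "p = (x, y)" "x \<in> P \<rightarrow>\<^sub>E A" "y \<in> P \<rightarrow>\<^sub>E A" by blast
  define a where "a = (\<lambda>i\<in>P. if x i = y i then Id_on A else A \<times> A - Id_on A)"
  have mem: "(x i, y i) \<in> a i" if "i \<in> P" for i using that p unfolding a_def by auto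
  then have "a i \<noteq> {}" if "i \<in> P" for i using that by blast
  then have "a \<in> P \<rightarrow>\<^sub>E trivial_scheme A" unfolding a_def trivial_scheme_def by auto
  moreover have "p \<in> tensor_rel P A a" using p mem unfolding tensor_rel_def by simp
  ultimately show "\<exists>X\<in>tensor_power P A (trivial_scheme A). p \<in> X"
    unfolding tensor_power_def by blast
qed

section \<open>Johnson and Cameron schemes through distance vectors\<close>

definition distances :: "'i set \<Rightarrow> ('i \<Rightarrow> nat set) \<Rightarrow> ('i \<Rightarrow> nat set) \<Rightarrow> 'i \<Rightarrow> nat" where
  "distances I u v = (\<lambda>i\<in>I. card (u i - v i))"

definition johnson_rel :: "nat \<Rightarrow> nat \<Rightarrow> nat \<Rightarrow> (nat set \<times> nat set) set" where
  "johnson_rel m k r = {(x, y). x \<in> ksubsets m k \<and> y \<in> ksubsets m k \<and> card (x - y) = r}"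

lemma johnson_scheme_eq: "johnson_scheme m k = johnson_rel m k ` {0..k} - {{}}"
  unfolding johnson_scheme_def johnson_rel_def by simp

lemma ksubsets_diff_le: "x \<in> ksubsets m k \<Longrightarrow> card (x - y) \<le> k"
  using card_mono[of x "x - y"] ksubsetsD[of x m k] by auto

lemma ksubsets_diff_0: "x \<in> ksubsets m k \<Longrightarrow> y \<in> ksubsets m k \<Longrightarrow> card (x - y) = 0 \<Longrightarrow> x = y"
  using ksubsetsD[of x m k] ksubsetsD[of y m k] by (simp add: card_subset_eq)

lemma distances_in:
  "u \<in> I \<rightarrow>\<^sub>E ksubsets m k \<Longrightarrow> distances I u v \<in> I \<rightarrow>\<^sub>E {..k}"
  unfolding distances_def by (auto intro!: ksubsets_diff_le)

text \<open>Two index vectors lie in the same orbit of the symmetric group iff their multisets of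
  entries agree, so the multiset of distances labels the relations.\<close>

lemma cameron_fibres:
  assumes I: "finite I"
  shows "sym_tensor_power I (ksubsets m k) (johnson_scheme m k) =
    fibres ((I \<rightarrow>\<^sub>E ksubsets m k) \<times> (I \<rightarrow>\<^sub>E ksubsets m k))
      (\<lambda>(u, v). image_mset (distances I u v) (mset_set I))"
    (is "?C = fibres (?V \<times> ?V) ?f")
proof (rule fibres_eqI)
  fix X assume "X \<in> ?C"
  then obtain a where a: "a \<in> I \<rightarrow>\<^sub>E johnson_scheme m k"
    "X = (\<Union>\<pi>\<in>{\<pi>. \<pi> permutes I}. tensor_rel I (ksubsets m k) (a \<circ> \<pi>))"
    unfolding sym_tensor_power_def by blast
  have "\<forall>i\<in>I. \<exists>r. a i = johnson_rel m k r" using a(1) unfolding johnson_scheme_eq by blast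
  then obtain r where r: "\<forall>i\<in>I. a i = johnson_rel m k (r i)" by metis
  have "tensor_rel I (ksubsets m k) a \<noteq> {}"
  proof (rule tensor_rel_nonempty)
    fix i assume "i \<in> I"
    then have "a i \<in> johnson_scheme m k" using a(1) by blast
    then show "a i \<noteq> {}" "a i \<subseteq> ksubsets m k \<times> ksubsets m k"
      unfolding johnson_scheme_eq johnson_rel_def by auto
  qed
  moreover have "tensor_rel I (ksubsets m k) a \<subseteq> X"
    using a(2) permutes_id[of I] by (metis (mono_tags, lifting) UN_upper comp_id mem_Collect_eq)
  ultimately show "X \<noteq> {}" by blast
  show "X \<subseteq> ?V \<times> ?V" using a(2) unfolding tensor_rel_def by blast
  have mem: "(u, v) \<in> X \<longleftrightarrow> image_mset (distances I u v) (mset_set I) = image_mset r (mset_set I)"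
    if uv: "u \<in> ?V" "v \<in> ?V" for u v
  proof -
    have "(u i, v i) \<in> a (\<pi> i) \<longleftrightarrow> distances I u v i = r (\<pi> i)"
      if "\<pi> permutes I" "i \<in> I" for i \<pi>
    proof -
      have "\<pi> i \<in> I" using that by (simp add: permutes_in_image)
      then have "a (\<pi> i) = johnson_rel m k (r (\<pi> i))" using r by blast
      then show ?thesis using uv that unfolding johnson_rel_def distances_def by auto
    qed
    then have "(u, v) \<in> X \<longleftrightarrow> (\<exists>\<pi>. \<pi> permutes I \<and> (\<forall>i\<in>I. distances I u v i = r (\<pi> i)))"
      using uv unfolding a(2) tensor_rel_def by auto
    also have "\<dots> \<longleftrightarrow> image_mset (distances I u v) (mset_set I) = image_mset r (mset_set I)"
    proof
      assume "\<exists>\<pi>. \<pi> permutes I \<and> (\<forall>i\<in>I. distances I u v i = r (\<pi> i))"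
      then obtain \<pi> where \<pi>: "\<pi> permutes I" "\<forall>i\<in>I. distances I u v i = r (\<pi> i)" by blast
      have "image_mset (distances I u v) (mset_set I) = image_mset (\<lambda>i. r (\<pi> i)) (mset_set I)"
        using \<pi>(2) I by (intro image_mset_cong) auto
      also have "\<dots> = image_mset r (image_mset \<pi> (mset_set I))"
        by (simp add: image_mset.compositionality comp_def)
      also have "image_mset \<pi> (mset_set I) = mset_set I"
        using \<pi>(1) by (simp add: permutes_image_mset)
      finally show "image_mset (distances I u v) (mset_set I) = image_mset r (mset_set I)" .
    next
      assume "image_mset (distances I u v) (mset_set I) = image_mset r (mset_set I)"
      from image_mset_eq_implies_permutes[OF I this]
      show "\<exists>\<pi>. \<pi> permutes I \<and> (\<forall>i\<in>I. distances I u v i = r (\<pi> i))" by blast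
    qed
    finally show ?thesis .
  qed
  fix p q assume "p \<in> X" "q \<in> ?V \<times> ?V"
  then show "q \<in> X \<longleftrightarrow> ?f q = ?f p"
    using mem \<open>X \<subseteq> ?V \<times> ?V\<close> by (cases p, cases q) auto
next
  fix p assume "p \<in> ?V \<times> ?V"
  then obtain u v where p: "p = (u, v)" "u \<in> ?V" "v \<in> ?V" by blast
  define a where "a = (\<lambda>i\<in>I. johnson_rel m k (card (u i - v i)))"
  have mem: "(u i, v i) \<in> a i" if "i \<in> I" for i
    using that p unfolding a_def johnson_rel_def by auto
  have "a \<in> I \<rightarrow>\<^sub>E johnson_scheme m k"
  proof
    fix i assume i: "i \<in> I"
    then have "card (u i - v i) \<le> k" using p by (intro ksubsets_diff_le[of _ m]) auto
    then show "a i \<in> johnson_scheme m k"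
      using mem[OF i] i unfolding a_def johnson_scheme_eq by auto
  qed (simp add: a_def)
  moreover have "p \<in> tensor_rel I (ksubsets m k) (a \<circ> id)"
    using p mem unfolding tensor_rel_def by simp
  then have "p \<in> (\<Union>\<pi>\<in>{\<pi>. \<pi> permutes I}. tensor_rel I (ksubsets m k) (a \<circ> \<pi>))"
    using permutes_id[of I] by blast
  ultimately show "\<exists>X\<in>?C. p \<in> X" unfolding sym_tensor_power_def by blast
qed

section \<open>Regrouping coordinates into blocks\<close>

lemma regroup_eq_iff:
  assumes "B \<in> P" "card B = e" "finite B"
  shows "regroup P e u B = regroup P e v B \<longleftrightarrow> (\<forall>i\<in>B. u i = v i)"
proof
  assume eq: "regroup P e u B = regroup P e v B"
  show "\<forall>i\<in>B. u i = v i"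
  proof
    fix i assume "i \<in> B"
    then have "i \<in> set (sorted_list_of_set B)" using assms by simp
    then obtain n where n: "n < e" "sorted_list_of_set B ! n = i"
      using assms unfolding in_set_conv_nth by auto
    \<comment> \<open>Entries of a block are numbered from 1 and list positions from 0, so position
      \<open>n\<close> is read at \<open>Suc n\<close>.\<close>
    have "regroup P e u B (Suc n) = regroup P e v B (Suc n)" using eq by simp
    then show "u i = v i" using n assms(1) unfolding regroup_def by simp
  qed
next
  assume "\<forall>i\<in>B. u i = v i"
  moreover have "sorted_list_of_set B ! (l - 1) \<in> B" if "l \<in> {1..e}" for l
    using nth_mem[of "l - 1" "sorted_list_of_set B"] that assms by auto
  ultimately show "regroup P e u B = regroup P e v B"
    using assms(1) unfolding regroup_def by (auto intro!: restrict_ext)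
qed

lemma card_blocks:
  assumes "finite I" "partition_on I P" "\<forall>B\<in>P. card B = e"
  shows "card I = e * card P"
proof -
  have "card (\<Union>P) = (\<Sum>B\<in>P. card B)"
    using assms partition_onD1[OF assms(2)] partition_onD2[OF assms(2)]
    by (intro card_Union_disjoint) (auto simp: disjoint_def pairwise_def disjnt_def intro: finite_subset)
  then show ?thesis using partition_onD1[OF assms(2)] assms(3) by simp
qed

text \<open>Injectivity holds since the blocks cover \<open>I\<close>. Surjectivity follows by
  counting, because \<open>card I = e * card P\<close> gives both function spaces the same finite
  size.\<close>

lemma regroup_bij:
  assumes I: "finite I" and P: "partition_on I P" "\<forall>B\<in>P. card B = e" and \<Omega>: "finite \<Omega>"
  shows "bij_betw (regroup P e) (I \<rightarrow>\<^sub>E \<Omega>) (P \<rightarrow>\<^sub>E ({1..e} \<rightarrow>\<^sub>E \<Omega>))"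
proof -
  let ?V = "I \<rightarrow>\<^sub>E \<Omega>" and ?W = "P \<rightarrow>\<^sub>E ({1..e} \<rightarrow>\<^sub>E \<Omega>)"
  have UP: "\<Union>P = I" using partition_onD1[OF P(1)] by simp
  have finB: "finite B" if "B \<in> P" for B using that UP I by (auto intro: finite_subset)
  have finP: "finite P" using UP I by (metis finite_UnionD)
  have inj: "inj_on (regroup P e) ?V"
  proof (rule inj_onI)
    fix u v assume uv: "u \<in> ?V" "v \<in> ?V" "regroup P e u = regroup P e v"
    show "u = v"
    proof (rule extensionalityI[of _ I])
      fix i assume "i \<in> I"
      then obtain B where B: "B \<in> P" "i \<in> B" using UP by blast
      have "regroup P e u B = regroup P e v B" using uv(3) by simp
      then show "u i = v i" using regroup_eq_iff[of B P e u v] B P(2) finB by blast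
    qed (use uv in \<open>auto simp: PiE_def\<close>)
  qed
  have "regroup P e u \<in> ?W" if u: "u \<in> ?V" for u
  proof -
    have "u (sorted_list_of_set B ! (l - 1)) \<in> \<Omega>" if "B \<in> P" "l \<in> {1..e}" for B l
    proof -
      have "sorted_list_of_set B ! (l - 1) \<in> B"
        using nth_mem[of "l - 1" "sorted_list_of_set B"] that P(2) finB[OF that(1)] by auto
      then show ?thesis using u that(1) UP by blast
    qed
    then show ?thesis unfolding regroup_def by auto
  qed
  then have sub: "regroup P e ` ?V \<subseteq> ?W" by blast
  have "card I = e * card P" using card_blocks[OF I P] .
  then have "card ?W = card ?V"
    using finP I by (simp add: card_PiE power_mult)
  moreover have "card (regroup P e ` ?V) = card ?V" using inj by (rule card_image)
  moreover have "finite ?W" using finP \<Omega> by (intro finite_PiE) auto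
  ultimately have "regroup P e ` ?V = ?W" using sub by (intro card_subset_eq) auto
  then show ?thesis using inj unfolding bij_betw_def by blast
qed

lemma partition_on_transport:
  assumes "bij_betw g V W" "partition_on (V \<times> V) \<X>"
  shows "partition_on (W \<times> W) (transport g \<X>)"
proof -
  have inj: "inj_on (map_prod g g) (V \<times> V)"
    using bij_betw_imp_inj_on[OF assms(1)] by (intro map_prod_inj_on)
  have img: "map_prod g g ` (V \<times> V) = W \<times> W"
    using bij_betw_imp_surj_on[OF assms(1)] by (simp add: map_prod_surj_on)
  \<comment> \<open>The library result on images of partitions discards the empty set; no class is
    empty, so nothing is lost.\<close>
  have "transport g \<X> = (`) (map_prod g g) ` \<X> - {{}}"
    using partition_onD3[OF assms(2)] unfolding transport_def by auto
  then show ?thesis using partition_on_inj_image[OF assms(2) inj] img by simp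
qed

section \<open>From fusions to limit equivalences\<close>

abbreviation base_point :: "'i set \<Rightarrow> nat \<Rightarrow> 'i \<Rightarrow> nat set" where
  "base_point I k \<equiv> (\<lambda>i\<in>I. shifted k 0)"

text \<open>
  The pairs \<open>(base_point I k, point I k c)\<close> represent the relations of the tensor power and do not
  depend on \<open>m\<close>; therefore the equivalence below can be compared for different \<open>m\<close>.
\<close>

definition point :: "'i set \<Rightarrow> nat \<Rightarrow> ('i \<Rightarrow> nat) \<Rightarrow> 'i \<Rightarrow> nat set" where
  "point I k c = (\<lambda>i\<in>I. shifted k (c i))"

definition index_equiv ::
  "'i set \<Rightarrow> nat \<Rightarrow> (('i \<Rightarrow> nat set) \<times> ('i \<Rightarrow> nat set)) set set \<Rightarrow> (('i \<Rightarrow> nat) \<times> ('i \<Rightarrow> nat)) set" where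
  "index_equiv I k \<X> = {(a, b). a \<in> I \<rightarrow>\<^sub>E {..k} \<and> b \<in> I \<rightarrow>\<^sub>E {..k} \<and>
     (\<exists>R\<in>\<X>. (base_point I k, point I k a) \<in> R \<and> (base_point I k, point I k b) \<in> R)}"

text \<open>With \<open>2 * k \<le> m\<close> all the shifted intervals fit into
  \<open>{1..m}\<close>, so every vector with entries at most \<open>k\<close> is the distance
  vector of some pair.\<close>

locale johnson_fusion =
  fixes I :: "nat set" and m k :: nat and \<X> :: "((nat \<Rightarrow> nat set) \<times> (nat \<Rightarrow> nat set)) set set"
  assumes I: "finite I" "I \<noteq> {}" and k: "k > 0" and m: "2 * k \<le> m"
    and fus: "fusion (I \<rightarrow>\<^sub>E ksubsets m k) (tensor_power I (ksubsets m k) (johnson_scheme m k)) \<X>"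
    and prim: "primitive (I \<rightarrow>\<^sub>E ksubsets m k) \<X>"
begin

abbreviation "\<Omega> \<equiv> ksubsets m k"
abbreviation "V \<equiv> I \<rightarrow>\<^sub>E \<Omega>"
abbreviation "L \<equiv> I \<rightarrow>\<^sub>E {..k}"
abbreviation "U \<equiv> base_point I k"
abbreviation "E \<equiv> index_equiv I k \<X>"

lemma scheme: "assoc_scheme V \<X>" using fus unfolding fusion_def by simp
lemma part: "partition_on (V \<times> V) \<X>" using scheme unfolding assoc_scheme_def by simp

lemma class_ex:
  assumes "u \<in> V" "v \<in> V" shows "\<exists>R\<in>\<X>. (u, v) \<in> R"
proof -
  have "(u, v) \<in> V \<times> V" using assms by (rule SigmaI)
  then have "(u, v) \<in> \<Union>\<X>" by (rule equalityD1[OF partition_onD1[OF part], THEN subsetD])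
  then show ?thesis by (elim UnionE bexI)
qed

lemma class_unique:
  assumes "R \<in> \<X>" "S \<in> \<X>" "p \<in> R" "p \<in> S" shows "R = S"
  using disjointD[OF partition_onD2[OF part] assms(1,2)] assms(3,4) by auto

lemma class_sub:
  assumes "R \<in> \<X>" "(u, v) \<in> R" shows "u \<in> V \<and> v \<in> V"
proof -
  have "(u, v) \<in> \<Union>\<X>" using assms by (rule UnionI)
  then have "(u, v) \<in> V \<times> V" by (rule equalityD2[OF partition_onD1[OF part], THEN subsetD])
  then show ?thesis by (simp only: mem_Sigma_iff)
qed

lemma U_in: "U \<in> V" using shifted_ksubsets[of 0 k m] m by simp

lemma point_in:
  assumes "c \<in> L" shows "point I k c \<in> V"
  unfolding point_def
proof (rule restrict_PiE_iff[THEN iffD2], rule ballI)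
  fix i assume "i \<in> I"
  then have "c i \<le> k" using assms by auto
  then show "shifted k (c i) \<in> \<Omega>" using m by (rule shifted_ksubsets)
qed

lemma distances_point:
  assumes "c \<in> L" shows "distances I U (point I k c) = c"
proof (rule extensionalityI[of _ I])
  fix i assume i: "i \<in> I"
  then have "c i \<le> k" using assms by auto
  then have "card (shifted k 0 - shifted k (0 + c i)) = c i" by (rule card_shifted_diff)
  then show "distances I U (point I k c) i = c i" using i unfolding distances_def point_def by simp
next
  show "c \<in> extensional I" using assms by (simp add: PiE_def)
qed (simp add: distances_def)

lemma E_L: "(a, b) \<in> E \<Longrightarrow> a \<in> L" "(a, b) \<in> E \<Longrightarrow> b \<in> L"
  unfolding index_equiv_def by blast+

lemma E_class:
  "(a, b) \<in> E \<Longrightarrow> \<exists>R\<in>\<X>. (U, point I k a) \<in> R \<and> (U, point I k b) \<in> R"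
  unfolding index_equiv_def by blast

text \<open>Pairs with the same distance vector lie in the same tensor relation, and this is
  contained in a single class of the fusion.\<close>

lemma class_cong:
  assumes R: "R \<in> \<X>" "(u, v) \<in> R" and uv': "u' \<in> V" "v' \<in> V"
    and eq: "distances I u v = distances I u' v'"
  shows "(u', v') \<in> R"
proof -
  have uv: "u \<in> V" "v \<in> V" using class_sub R by auto
  define a where "a = (\<lambda>i\<in>I. johnson_rel m k (distances I u v i))"
  have mem: "(u, v) \<in> tensor_rel I \<Omega> a"
    using uv by (auto simp: tensor_rel_def a_def johnson_rel_def distances_def)
  have mem': "(u', v') \<in> tensor_rel I \<Omega> a"
    using uv' unfolding eq a_def by (auto simp: tensor_rel_def johnson_rel_def distances_def)
  have "a \<in> I \<rightarrow>\<^sub>E johnson_scheme m k"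
  proof
    fix i assume i: "i \<in> I"
    have "(u i, v i) \<in> a i" using mem i unfolding tensor_rel_def by blast
    moreover have "distances I u v i \<in> {0..k}" using distances_in[OF uv(1)] i by auto
    ultimately show "a i \<in> johnson_scheme m k"
      using i unfolding a_def johnson_scheme_eq by auto
  qed (simp add: a_def)
  then have "tensor_rel I \<Omega> a \<in> tensor_power I \<Omega> (johnson_scheme m k)"
    unfolding tensor_power_def by blast
  then obtain S where "S \<in> \<X>" "tensor_rel I \<Omega> a \<subseteq> S"
    using fus unfolding fusion_def refines_def by blast
  then show ?thesis using class_unique[OF R(1) _ R(2)] mem mem' by blast
qed

lemma class_point_iff:
  assumes "R \<in> \<X>" "u \<in> V" "v \<in> V"
  shows "(u, v) \<in> R \<longleftrightarrow> (U, point I k (distances I u v)) \<in> R"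
proof -
  have d: "distances I u v \<in> L" using distances_in assms(2) by blast
  show ?thesis
    using class_cong[OF assms(1) _ assms(2,3), of U "point I k (distances I u v)"]
      class_cong[OF assms(1) _ U_in point_in[OF d], of u v] distances_point[OF d] by auto
qed

text \<open>This is the dictionary between classes of pairs and classes of index vectors; it lets
  results on \<open>E\<close> be carried back to the fusion.\<close>

lemma in_E_iff:
  assumes "R \<in> \<X>" "(u, v) \<in> R" "u' \<in> V" "v' \<in> V"
  shows "(distances I u v, distances I u' v') \<in> E \<longleftrightarrow> (u', v') \<in> R"
proof -
  have uv: "u \<in> V" "v \<in> V" using class_sub assms by auto
  have 1: "(U, point I k (distances I u v)) \<in> R" using class_point_iff assms(1,2) uv by blast
  have "(distances I u v, distances I u' v') \<in> E \<longleftrightarrow> (U, point I k (distances I u' v')) \<in> R"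
    using distances_in[OF uv(1)] distances_in[OF assms(3)] 1 assms(1) class_unique
    unfolding index_equiv_def by blast
  then show ?thesis using class_point_iff[OF assms(1,3,4)] by simp
qed

lemma in_E_iff_point:
  assumes "R \<in> \<X>" "(U, point I k c) \<in> R" "c \<in> L" "u' \<in> V" "v' \<in> V"
  shows "(c, distances I u' v') \<in> E \<longleftrightarrow> (u', v') \<in> R"
  using in_E_iff[OF assms(1,2,4,5)] distances_point[OF assms(3)] by simp

lemma point_zero: "point I k (\<lambda>i\<in>I. 0) = U"
  unfolding point_def by (intro restrict_ext) simp

lemma equiv_E: "equiv L E"
proof (rule equivI)
  show "E \<subseteq> L \<times> L" unfolding index_equiv_def by blast
  show "refl_on L E"
  proof (rule refl_onI)
    fix a assume a: "a \<in> L"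
    then obtain R where "R \<in> \<X>" "(U, point I k a) \<in> R" using class_ex[OF U_in point_in] by blast
    then show "(a, a) \<in> E" using a unfolding index_equiv_def by blast
  qed
  show "sym E" by (rule symI) (auto simp: index_equiv_def)
  show "trans E"
  proof (rule transI)
    fix a b c assume ab: "(a, b) \<in> E" and bc: "(b, c) \<in> E"
    obtain R where R: "R \<in> \<X>" "(U, point I k a) \<in> R" "(U, point I k b) \<in> R"
      using ab unfolding index_equiv_def by blast
    obtain S where S: "S \<in> \<X>" "(U, point I k b) \<in> S" "(U, point I k c) \<in> S"
      using bc unfolding index_equiv_def by blast
    have "R = S" using class_unique[OF R(1) S(1) R(3) S(2)] .
    then show "(a, c) \<in> E" using R S(3) ab bc unfolding index_equiv_def by blast
  qed
qed

lemma E_zero: "(\<lambda>i\<in>I. 0, a) \<in> E \<Longrightarrow> a = (\<lambda>i\<in>I. 0)"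
proof -
  assume E: "(\<lambda>i\<in>I. 0, a) \<in> E"
  then have a: "a \<in> L" unfolding index_equiv_def by blast
  have Id: "Id_on V \<in> \<X>" using scheme unfolding assoc_scheme_def by simp
  obtain R where R: "R \<in> \<X>" "(U, U) \<in> R" "(U, point I k a) \<in> R"
    using E_class[OF E] unfolding point_zero by blast
  then have "R = Id_on V" using class_unique[OF R(1) Id R(2)] U_in by blast
  then have "point I k a = U" using R(3) by auto
  then have "a = distances I U U" using distances_point[OF a] by simp
  then show ?thesis unfolding distances_def by (auto simp: fun_eq_iff)
qed

text \<open>If every index in the class vanished at \<open>j\<close>, no step along \<open>R\<close>
  would change coordinate \<open>j\<close>. Primitivity, however, connects \<open>U\<close> with the
  point of the all-one vector, which differs from \<open>U\<close> at \<open>j\<close>.\<close>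

lemma E_cover:
  assumes a: "a \<in> L" "a \<noteq> (\<lambda>i\<in>I. 0)" and j: "j \<in> I"
  shows "\<exists>b. (a, b) \<in> E \<and> b j \<noteq> 0"
proof (rule ccontr)
  assume "\<not> ?thesis"
  then have no: "b j = 0" if "(a, b) \<in> E" for b using that by blast
  obtain R where R: "R \<in> \<X>" "(U, point I k a) \<in> R" using class_ex[OF U_in point_in[OF a(1)]] by blast
  have "R \<noteq> Id_on V"
  proof
    assume "R = Id_on V"
    then have "(U, U) \<in> R" using U_in by auto
    then have "(a, distances I U U) \<in> E" using in_E_iff_point[OF R a(1) U_in U_in] by simp
    moreover have "distances I U U = (\<lambda>i\<in>I. 0)" unfolding distances_def by (auto simp: fun_eq_iff)
    ultimately have "(\<lambda>i\<in>I. 0, a) \<in> E"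
      using equiv_E unfolding equiv_def by (metis symD)
    then show False using E_zero a(2) by blast
  qed
  then have conn: "(x, y) \<in> R\<^sup>*" if "x \<in> V" "y \<in> V" for x y
    using prim R(1) that unfolding primitive_def by blast
  have step: "x j = y j" if xy: "(x, y) \<in> R" for x y
  proof -
    have V: "x \<in> V" "y \<in> V" using class_sub[OF R(1) xy] by auto
    have "distances I x y j = 0" using no in_E_iff_point[OF R a(1) V] xy by blast
    then show ?thesis using ksubsets_diff_0[of "x j" m k "y j"] V j unfolding distances_def by auto
  qed
  have "x j = y j" if "(x, y) \<in> R\<^sup>*" for x y
    using that by (induction rule: rtrancl_induct) (auto dest: step)
  moreover have one: "(\<lambda>i\<in>I. 1) \<in> L" using k by auto
  ultimately have "U j = point I k (\<lambda>i\<in>I. 1) j" using conn[OF U_in point_in] by blast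
  then have "shifted k 0 = shifted k 1" using j unfolding point_def by simp
  then show False using k unfolding shifted_def by auto
qed

text \<open>The point of \<open>a\<close> is a middle vertex between \<open>U\<close> and the point
  of \<open>c\<close>, at distance vectors \<open>a\<close> and \<open>b\<close>. So the
  intersection number of \<open>R\<close> and \<open>S\<close> on \<open>T\<close> is nonzero, and a
  middle vertex \<open>z'\<close> exists for \<open>c'\<close> too. The inequality is the triangle
  inequality in each coordinate.\<close>

lemma E_compose:
  assumes E: "(c, c') \<in> E" and ab: "a \<in> L" "b \<in> L" and c: "\<forall>i\<in>I. c i = a i + b i"
  shows "\<exists>a' b'. (a, a') \<in> E \<and> (b, b') \<in> E \<and> (\<forall>i\<in>I. c' i \<le> a' i + b' i)"
proof -
  have cL: "c \<in> L" "c' \<in> L" using E_L[OF E] .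
  obtain T where T: "T \<in> \<X>" "(U, point I k c) \<in> T" "(U, point I k c') \<in> T"
    using E_class[OF E] by blast
  let ?z = "point I k a"
  have z: "?z \<in> V" using point_in ab by blast
  obtain R where R: "R \<in> \<X>" "(U, ?z) \<in> R" using class_ex[OF U_in z] by blast
  obtain S where S: "S \<in> \<X>" "(?z, point I k c) \<in> S" using class_ex[OF z point_in[OF cL(1)]] by blast
  have dz: "distances I ?z (point I k c) = b"
  proof (rule extensionalityI[of _ I])
    fix i assume i: "i \<in> I"
    then have "b i \<le> k" using ab(2) by auto
    then have "card (shifted k (a i) - shifted k (a i + b i)) = b i" by (rule card_shifted_diff)
    then show "distances I ?z (point I k c) i = b i"
      using i c unfolding distances_def point_def by simp
  next
    show "b \<in> extensional I" using ab(2) by (simp add: PiE_def)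
  qed (simp add: distances_def)
  obtain p where p: "\<forall>(x, y)\<in>T. card {z \<in> V. (x, z) \<in> R \<and> (z, y) \<in> S} = p"
    using scheme R S T unfolding assoc_scheme_def by meson
  have finV: "finite V" using scheme unfolding assoc_scheme_def by simp
  define Z where "Z y = {z \<in> V. (U, z) \<in> R \<and> (z, y) \<in> S}" for y
  have finZ: "finite (Z y)" for y using finV unfolding Z_def by simp
  have "?z \<in> Z (point I k c)" using z R S unfolding Z_def by simp
  then have "card (Z (point I k c)) \<noteq> 0" using card_0_eq[OF finZ] by (metis empty_iff)
  moreover have "card (Z (point I k c)) = p" "card (Z (point I k c')) = p"
    using bspec[OF p T(2)] bspec[OF p T(3)] unfolding Z_def by simp_all
  ultimately have "Z (point I k c') \<noteq> {}" by force
  then obtain z' where z': "z' \<in> V" "(U, z') \<in> R" "(z', point I k c') \<in> S"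
    unfolding Z_def by blast
  let ?v = "point I k c'"
  have "(a, distances I U z') \<in> E" using in_E_iff_point[OF R ab(1) U_in z'(1)] z'(2) by blast
  moreover have "(b, distances I z' ?v) \<in> E"
    using in_E_iff[OF S z'(1) point_in[OF cL(2)]] z'(3) dz by simp
  moreover have "c' i \<le> distances I U z' i + distances I z' ?v i" if i: "i \<in> I" for i
  proof -
    have fin: "finite (U i)" "finite (z' i)" using U_in z' i ksubsetsD(1) by blast+
    have "distances I U ?v i = card (U i - ?v i)" using i unfolding distances_def by (rule restrict_apply')
    then have "c' i = card (U i - ?v i)" unfolding distances_point[OF cL(2)] .
    also have "\<dots> \<le> card ((U i - z' i) \<union> (z' i - ?v i))" using fin by (intro card_mono) auto
    also have "\<dots> \<le> card (U i - z' i) + card (z' i - ?v i)" by (rule card_Un_le)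
    finally show ?thesis using i unfolding distances_def by simp
  qed
  ultimately show ?thesis by blast
qed

text \<open>The middle vertices are sorted by their distance vectors \<open>a\<close> and
  \<open>b\<close> to the two ends; for fixed \<open>a\<close> and \<open>b\<close> the conditions
  on the coordinates are independent, which gives a product.\<close>

lemma card_paths:
  assumes R: "R \<in> \<X>" and D: "D = {a \<in> L. (U, point I k a) \<in> R}" and c: "c \<in> L"
  shows "card {z \<in> V. (U, z) \<in> R \<and> (z, point I k c) \<in> R} = path_count m k I D c"
proof -
  let ?v = "point I k c"
  define Z where "Z = (\<lambda>(a, b). {z \<in> V. distances I U z = a \<and> distances I z ?v = b})"
  have finV: "finite V" using scheme unfolding assoc_scheme_def by simp
  have finD: "finite D" unfolding D using I by (simp add: finite_PiE)
  have v: "?v \<in> V" using point_in c by blast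
  have "(U, z) \<in> R \<longleftrightarrow> distances I U z \<in> D" "(z, ?v) \<in> R \<longleftrightarrow> distances I z ?v \<in> D" if "z \<in> V" for z
    using class_point_iff[OF R U_in that] class_point_iff[OF R that v]
      distances_in[OF U_in, of z] distances_in[OF that, of ?v] unfolding D by simp_all
  then have "{z \<in> V. (U, z) \<in> R \<and> (z, ?v) \<in> R} = (\<Union>ab\<in>D \<times> D. Z ab)"
    unfolding Z_def by auto
  also have "card \<dots> = (\<Sum>ab\<in>D \<times> D. card (Z ab))"
    using finD finV unfolding Z_def by (intro card_UN_disjoint) auto
  also have "\<dots> = (\<Sum>(a, b)\<in>D \<times> D. \<Prod>i\<in>I. inum m k (a i) (b i) (c i))"
  proof (intro sum.cong refl, clarify)
    fix a b assume ab: "a \<in> D" "b \<in> D"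
    have ext: "a \<in> extensional I" "b \<in> extensional I" using ab unfolding D by (auto simp: PiE_def)
    have "Z (a, b) = (\<Pi>\<^sub>E i\<in>I. {z \<in> \<Omega>. card (shifted k 0 - z) = a i \<and> card (z - shifted k (c i)) = b i})"
    proof (intro equalityI subsetI)
      fix z assume "z \<in> Z (a, b)"
      then have z: "z \<in> V" "a = distances I U z" "b = distances I z ?v" unfolding Z_def by auto
      then show "z \<in> (\<Pi>\<^sub>E i\<in>I. {z \<in> \<Omega>. card (shifted k 0 - z) = a i \<and> card (z - shifted k (c i)) = b i})"
        by (auto simp: distances_def point_def PiE_iff)
    next
      fix z assume z: "z \<in> (\<Pi>\<^sub>E i\<in>I. {z \<in> \<Omega>. card (shifted k 0 - z) = a i \<and> card (z - shifted k (c i)) = b i})"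
      then have "distances I U z = a" "distances I z ?v = b"
        using ext by (auto intro!: extensionalityI[of _ I] simp: distances_def point_def PiE_iff)
      then show "z \<in> Z (a, b)" using z unfolding Z_def by (auto simp: PiE_iff)
    qed
    then show "card (Z (a, b)) = (\<Prod>i\<in>I. inum m k (a i) (b i) (c i))"
      using I by (simp add: card_PiE inum_def)
  qed
  also have "\<dots> = path_count m k I D c"
    unfolding path_count_def by (simp add: sum.cartesian_product)
  finally show ?thesis .
qed

lemma path_count_eq:
  assumes x: "x \<in> L" and E: "(c, c') \<in> E"
  shows "path_count m k I (E `` {x}) c = path_count m k I (E `` {x}) c'"
proof -
  have cL: "c \<in> L" "c' \<in> L" using E_L[OF E] .
  obtain T where T: "T \<in> \<X>" "(U, point I k c) \<in> T" "(U, point I k c') \<in> T"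
    using E_class[OF E] by blast
  obtain R where R: "R \<in> \<X>" "(U, point I k x) \<in> R" using class_ex[OF U_in point_in[OF x]] by blast
  have D: "E `` {x} = {a \<in> L. (U, point I k a) \<in> R}"
    using R x class_unique unfolding index_equiv_def by blast
  obtain p where p: "\<forall>(x, y)\<in>T. card {z \<in> V. (x, z) \<in> R \<and> (z, y) \<in> R} = p"
    using scheme R T unfolding assoc_scheme_def by meson
  have "card {z \<in> V. (U, z) \<in> R \<and> (z, point I k c) \<in> R} = card {z \<in> V. (U, z) \<in> R \<and> (z, point I k c') \<in> R}"
    using bspec[OF p T(2)] bspec[OF p T(3)] by simp
  then show ?thesis using card_paths[OF R(1) D] cL by simp
qed

lemma refines_cameron:
  assumes "cameron_type I E"
  shows "refines (V \<times> V) \<X> (sym_tensor_power I \<Omega> (johnson_scheme m k))"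
  unfolding cameron_fibres[OF I(1)]
proof (rule refines_fibresI[OF part])
  fix R p q assume R: "R \<in> \<X>" "p \<in> R" "q \<in> R"
  obtain u v u' v' where pq: "p = (u, v)" "q = (u', v')" by (cases p, cases q)
  then have "(distances I u v, distances I u' v') \<in> E"
    using in_E_iff[of R u v u' v'] class_sub[of R u' v'] R by blast
  then show "(\<lambda>(u, v). image_mset (distances I u v) (mset_set I)) p
    = (\<lambda>(u, v). image_mset (distances I u v) (mset_set I)) q"
    using assms pq unfolding cameron_type_def by auto
qed

text \<open>Regrouping turns the blocks touched by a distance vector into the coordinates in which
  two points differ. The two clauses of \<open>hamming_type\<close> on \<open>touched\<close> then
  yield one refinement each.\<close>

lemma refines_blocks:
  assumes "hamming_type I k E e P"
  shows "refines ((P \<rightarrow>\<^sub>E ({1..e} \<rightarrow>\<^sub>E \<Omega>)) \<times> (P \<rightarrow>\<^sub>E ({1..e} \<rightarrow>\<^sub>E \<Omega>)))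
      (tensor_power P ({1..e} \<rightarrow>\<^sub>E \<Omega>) (trivial_scheme ({1..e} \<rightarrow>\<^sub>E \<Omega>))) (transport (regroup P e) \<X>)"
    and "refines ((P \<rightarrow>\<^sub>E ({1..e} \<rightarrow>\<^sub>E \<Omega>)) \<times> (P \<rightarrow>\<^sub>E ({1..e} \<rightarrow>\<^sub>E \<Omega>)))
      (transport (regroup P e) \<X>) (hamming_scheme P ({1..e} \<rightarrow>\<^sub>E \<Omega>))"
proof -
  have P: "partition_on I P" "\<forall>B\<in>P. card B = e"
    and tou: "\<forall>c\<in>L. \<forall>c'\<in>L. touched P c = touched P c' \<longrightarrow> (c, c') \<in> E"
    and inv: "\<forall>(c, c')\<in>E. card (touched P c) = card (touched P c')"
    using assms unfolding hamming_type_def by blast+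
  let ?A = "{1..e} \<rightarrow>\<^sub>E \<Omega>" and ?g = "regroup P e"
  let ?W = "P \<rightarrow>\<^sub>E ?A"
  have UP: "\<Union>P = I" using partition_onD1[OF P(1)] by simp
  have finP: "finite P" using UP I by (metis finite_UnionD)
  have bij: "bij_betw ?g V ?W" using regroup_bij[OF I(1) P finite_ksubsets] .
  have part': "partition_on (?W \<times> ?W) (transport ?g \<X>)" using partition_on_transport[OF bij part] .
  \<comment> \<open>A block component changes iff some coordinate inside the block changes, that is,
    iff the distance there is nonzero.\<close>
  have diff: "{B \<in> P. ?g u B \<noteq> ?g v B} = touched P (distances I u v)" if uv: "u \<in> V" "v \<in> V" for u v
  proof -
    have "?g u B \<noteq> ?g v B \<longleftrightarrow> (\<exists>i\<in>B. distances I u v i \<noteq> 0)" if B: "B \<in> P" for B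
    proof -
      have BI: "B \<subseteq> I" using B UP by blast
      then have "?g u B \<noteq> ?g v B \<longleftrightarrow> (\<exists>i\<in>B. u i \<noteq> v i)"
        using regroup_eq_iff[of B P e u v] B P(2) finite_subset[OF BI I(1)] by blast
      also have "\<dots> \<longleftrightarrow> (\<exists>i\<in>B. distances I u v i \<noteq> 0)"
      proof (intro bex_cong refl)
        fix i assume "i \<in> B"
        then have i: "i \<in> I" using BI by blast
        have "u i \<in> \<Omega>" "v i \<in> \<Omega>" using uv i by auto
        then show "(u i \<noteq> v i) = (distances I u v i \<noteq> 0)"
          using ksubsets_diff_0[of "u i" m k "v i"] i unfolding distances_def by auto
      qed
      finally show ?thesis .
    qed
    then show ?thesis unfolding touched_def by blast
  qed
  have pull: "\<exists>u v. u \<in> V \<and> v \<in> V \<and> q = (?g u, ?g v)" if q: "q \<in> ?W \<times> ?W" for q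
  proof -
    have surj: "?g ` V = ?W" using bij_betw_imp_surj_on[OF bij] .
    obtain x y where xy: "q = (x, y)" "x \<in> ?W" "y \<in> ?W" using q by (rule SigmaE)
    obtain u where "x = ?g u" "u \<in> V" using xy(2) unfolding surj[symmetric] by (rule imageE)
    moreover obtain v where "y = ?g v" "v \<in> V" using xy(3) unfolding surj[symmetric] by (rule imageE)
    ultimately show ?thesis using xy(1) by blast
  qed
  have pull_class: "\<exists>R u v. R \<in> \<X> \<and> X = map_prod ?g ?g ` R \<and> (u, v) \<in> R \<and> p = (?g u, ?g v)"
    if "X \<in> transport ?g \<X>" "p \<in> X" for X p
    using that unfolding transport_def by auto
  show "refines (?W \<times> ?W) (tensor_power P ?A (trivial_scheme ?A)) (transport ?g \<X>)"
    unfolding trivial_power_fibres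
  proof (rule fibres_refinesI[OF part'])
    fix X p q assume X: "X \<in> transport ?g \<X>" "p \<in> X" and q: "q \<in> ?W \<times> ?W"
      and eq: "(\<lambda>(x, y). {i \<in> P. x i \<noteq> y i}) q = (\<lambda>(x, y). {i \<in> P. x i \<noteq> y i}) p"
    obtain R u v where R: "R \<in> \<X>" "X = map_prod ?g ?g ` R" "(u, v) \<in> R" "p = (?g u, ?g v)"
      using pull_class[OF X] by blast
    obtain u' v' where q': "u' \<in> V" "v' \<in> V" "q = (?g u', ?g v')" using pull[OF q] by blast
    have uv: "u \<in> V" "v \<in> V" using class_sub[OF R(1,3)] by auto
    have "touched P (distances I u v) = touched P (distances I u' v')"
      using eq diff[OF uv] diff[OF q'(1,2)] R(4) q'(3) by simp
    then have "(distances I u v, distances I u' v') \<in> E"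
      using tou distances_in[OF uv(1)] distances_in[OF q'(1)] by blast
    then have "(u', v') \<in> R" using in_E_iff[OF R(1,3) q'(1,2)] by blast
    then show "q \<in> X" using R(2) q'(3) by force
  qed
  show "refines (?W \<times> ?W) (transport ?g \<X>) (hamming_scheme P ?A)"
    unfolding hamming_scheme_fibres[OF finP]
  proof (rule refines_fibresI[OF part'])
    fix X p q assume X: "X \<in> transport ?g \<X>" "p \<in> X" "q \<in> X"
    obtain R u v where R: "R \<in> \<X>" "X = map_prod ?g ?g ` R" "(u, v) \<in> R" "p = (?g u, ?g v)"
      using pull_class[OF X(1,2)] by blast
    obtain u' v' where q: "(u', v') \<in> R" "q = (?g u', ?g v')" using X(3) R(2) by auto
    have uv: "u \<in> V" "v \<in> V" "u' \<in> V" "v' \<in> V"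
      using class_sub[OF R(1,3)] class_sub[OF R(1) q(1)] by auto
    have "(distances I u v, distances I u' v') \<in> E"
      using in_E_iff[OF R(1,3) uv(3,4)] q(1) by blast
    then have "card (touched P (distances I u v)) = card (touched P (distances I u' v'))"
      using inv by blast
    then show "(\<lambda>(x, y). card {i \<in> P. x i \<noteq> y i}) p = (\<lambda>(x, y). card {i \<in> P. x i \<noteq> y i}) q"
      using diff[OF uv(1,2)] diff[OF uv(3,4)] R(4) q(2) by simp
  qed
qed

end

section \<open>Pigeonhole over the finitely many equivalences\<close>

text \<open>All combinatorial conditions are inherited from the fusion for one single
  \<open>m\<close>; only the constancy of \<open>leading\<close> draws on infinitely many of
  them.\<close>

lemma limit_fusion_if_infinitely_often:
  fixes I :: "nat set"
  assumes inf: "infinite M"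
    and fusM: "\<And>m. m \<in> M \<Longrightarrow> johnson_fusion I m k (\<X> m)"
    and E: "\<And>m. m \<in> M \<Longrightarrow> index_equiv I k (\<X> m) = E"
  shows "limit_fusion I k E"
proof -
  obtain n where n: "n \<in> M" using inf by (metis finite.emptyI all_not_in_conv)
  interpret johnson_fusion I n k "\<X> n" using fusM[OF n] .
  note En = E[OF n]
  show ?thesis
  proof
    show "finite I" "I \<noteq> {}" "k > 0" using I k by auto
    show "equiv (I \<rightarrow>\<^sub>E {..k}) E" using equiv_E unfolding En .
    show "a = (\<lambda>i\<in>I. 0)" if "(\<lambda>i\<in>I. 0, a) \<in> E" for a
      using E_zero that unfolding En .
    show "\<exists>b. (a, b) \<in> E \<and> b i \<noteq> 0"
      if "a \<in> I \<rightarrow>\<^sub>E {..k}" "a \<noteq> (\<lambda>i\<in>I. 0)" "i \<in> I" for a i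
      using E_cover that unfolding En .
    show "\<exists>a' b'. (a, a') \<in> E \<and> (b, b') \<in> E \<and> (\<forall>i\<in>I. c' i \<le> a' i + b' i)"
      if "(c, c') \<in> E" "a \<in> I \<rightarrow>\<^sub>E {..k}" "b \<in> I \<rightarrow>\<^sub>E {..k}" "\<forall>i\<in>I. c i = a i + b i" for a b c c'
      using E_compose that unfolding En .
    show "leading k I (E `` {x}) c = leading k I (E `` {x}) c'"
      if x: "x \<in> I \<rightarrow>\<^sub>E {..k}" and cc': "(c, c') \<in> E" for x c c'
    proof (rule leading_eq_if_infinitely_often[OF I(1) _ _ _ inf])
      show "E `` {x} \<subseteq> I \<rightarrow>\<^sub>E {..k}" "c \<in> I \<rightarrow>\<^sub>E {..k}" "c' \<in> I \<rightarrow>\<^sub>E {..k}"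
        using cc' unfolding En[symmetric] index_equiv_def by auto
      show "path_count m k I (E `` {x}) c = path_count m k I (E `` {x}) c'" if m: "m \<in> M" for m
        using johnson_fusion.path_count_eq[OF fusM[OF m] x] cc' unfolding E[OF m] .
    qed
  qed
qed

text \<open>Were there infinitely many bad \<open>m\<close>, one bad fusion could be chosen for
  each. Only finitely many equivalences exist on vectors with entries at most \<open>k\<close>, so
  one of them would recur infinitely often and fall under \<open>cameron_or_hamming\<close>.\<close>

lemma eventually_cameron_or_hamming:
  assumes I: "finite I"
  shows "\<exists>m\<^sub>0. \<forall>m\<ge>m\<^sub>0. \<forall>\<X>. johnson_fusion I m k \<X> \<longrightarrow>
    cameron_type I (index_equiv I k \<X>) \<or> (\<exists>e>0. \<exists>P. hamming_type I k (index_equiv I k \<X>) e P)"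
proof -
  define G where "G E \<longleftrightarrow> cameron_type I E \<or> (\<exists>e>0. \<exists>P. hamming_type I k E e P)" for E
  define M where "M = {m. \<exists>\<X>. johnson_fusion I m k \<X> \<and> \<not> G (index_equiv I k \<X>)}"
  have "finite M"
  proof (rule ccontr)
    assume inf: "infinite M"
    have "\<forall>m\<in>M. \<exists>\<X>. johnson_fusion I m k \<X> \<and> \<not> G (index_equiv I k \<X>)" unfolding M_def by simp
    then obtain \<X> where \<X>: "\<And>m. m \<in> M \<Longrightarrow> johnson_fusion I m k (\<X> m)"
      "\<And>m. m \<in> M \<Longrightarrow> \<not> G (index_equiv I k (\<X> m))" by metis
    let ?L = "I \<rightarrow>\<^sub>E {..k}"
    have "finite (Pow (?L \<times> ?L))" using I by (simp add: finite_PiE)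
    moreover have "(\<lambda>m. index_equiv I k (\<X> m)) ` M \<subseteq> Pow (?L \<times> ?L)"
      unfolding index_equiv_def by blast
    ultimately have "finite ((\<lambda>m. index_equiv I k (\<X> m)) ` M)" by (rule rev_finite_subset)
    from pigeonhole_infinite[OF inf this] obtain n where n: "n \<in> M"
      "infinite {m \<in> M. index_equiv I k (\<X> m) = index_equiv I k (\<X> n)}" by blast
    have "limit_fusion I k (index_equiv I k (\<X> n))"
      by (rule limit_fusion_if_infinitely_often[OF n(2), of I k \<X>]) (simp_all add: \<X>)
    from limit_fusion.cameron_or_hamming[OF this]
    have "G (index_equiv I k (\<X> n))" unfolding G_def .
    then show False using \<X>(2)[OF n(1)] by simp
  qed
  then obtain N where "\<forall>m\<in>M. m < N" using finite_nat_set_iff_bounded by blast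
  then have "\<forall>m\<ge>N. m \<notin> M" by (meson leD)
  then have "\<forall>m\<ge>N. \<forall>\<X>. johnson_fusion I m k \<X> \<longrightarrow> G (index_equiv I k \<X>)" unfolding M_def by simp
  then show ?thesis unfolding G_def by (rule exI[of _ N])
qed

theorem theorem1p1:
  fixes k d :: nat
  assumes "k > 0" and "d > 0"
  shows "\<exists>m\<^sub>0::nat. \<forall>m\<ge>m\<^sub>0. \<forall>\<X> :: ((nat \<Rightarrow> nat set) \<times> (nat \<Rightarrow> nat set)) set set.
    let \<Omega> = ksubsets m k;
        V = {1..d} \<rightarrow>\<^sub>E \<Omega>;
        J = tensor_power {1..d} \<Omega> (johnson_scheme m k)
    in fusion V J \<X> \<and> primitive V \<X> \<longrightarrow>
       (refines (V \<times> V) J \<X> \<and> refines (V \<times> V) \<X> (cameron_scheme m k d)) \<or>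
       (\<exists>e>0. e dvd d \<and>
         (\<exists>P. partition_on {1..d} P \<and> card P = d div e \<and> (\<forall>B\<in>P. card B = e) \<and>
           (let A = {1..e} \<rightarrow>\<^sub>E \<Omega>;
                W = P \<rightarrow>\<^sub>E A;
                \<Y> = transport (regroup P e) \<X>
            in refines (W \<times> W) (tensor_power P A (trivial_scheme A)) \<Y> \<and>
               refines (W \<times> W) \<Y> (hamming_scheme P A))))"
proof -
  let ?I = "{1..d}"
  have I: "finite ?I" "?I \<noteq> {}" using assms(2) by auto
  obtain m\<^sub>1 where m\<^sub>1: "\<forall>m\<ge>m\<^sub>1. \<forall>\<X>. johnson_fusion ?I m k \<X> \<longrightarrow>
    cameron_type ?I (index_equiv ?I k \<X>) \<or> (\<exists>e>0. \<exists>P. hamming_type ?I k (index_equiv ?I k \<X>) e P)"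
    using eventually_cameron_or_hamming[OF I(1)] by (rule exE)
  show ?thesis
    unfolding Let_def
  \<comment> \<open>The bound \<open>2 * k\<close> is the size of \<open>m\<close> required by
    \<open>johnson_fusion\<close>.\<close>
  proof (rule exI[of _ "max m\<^sub>1 (2 * k)"], intro allI impI, elim conjE)
    fix m \<X>
    assume m_ge: "max m\<^sub>1 (2 * k) \<le> m"
      and fus: "fusion (?I \<rightarrow>\<^sub>E ksubsets m k) (tensor_power ?I (ksubsets m k) (johnson_scheme m k)) \<X>"
      and prim: "primitive (?I \<rightarrow>\<^sub>E ksubsets m k) \<X>"
    interpret johnson_fusion ?I m k \<X>
      using assms(1) I m_ge fus prim by unfold_locales auto
    have "m\<^sub>1 \<le> m" using m_ge by simp
    with m\<^sub>1 johnson_fusion_axioms have "cameron_type ?I E \<or> (\<exists>e>0. \<exists>P. hamming_type ?I k E e P)"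
      by simp
    then consider (cameron) "cameron_type ?I E" | (hamming) e P where "e > 0" "hamming_type ?I k E e P"
      by (elim disjE exE conjE)
    then show "refines (V \<times> V) (tensor_power ?I \<Omega> (johnson_scheme m k)) \<X> \<and>
        refines (V \<times> V) \<X> (cameron_scheme m k d) \<or>
      (\<exists>e>0. e dvd d \<and>
         (\<exists>P. partition_on ?I P \<and> card P = d div e \<and> (\<forall>B\<in>P. card B = e) \<and>
            refines ((P \<rightarrow>\<^sub>E ({1..e} \<rightarrow>\<^sub>E \<Omega>)) \<times> (P \<rightarrow>\<^sub>E ({1..e} \<rightarrow>\<^sub>E \<Omega>)))
              (tensor_power P ({1..e} \<rightarrow>\<^sub>E \<Omega>) (trivial_scheme ({1..e} \<rightarrow>\<^sub>E \<Omega>)))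
              (transport (regroup P e) \<X>) \<and>
            refines ((P \<rightarrow>\<^sub>E ({1..e} \<rightarrow>\<^sub>E \<Omega>)) \<times> (P \<rightarrow>\<^sub>E ({1..e} \<rightarrow>\<^sub>E \<Omega>)))
              (transport (regroup P e) \<X>) (hamming_scheme P ({1..e} \<rightarrow>\<^sub>E \<Omega>))))"
    proof cases
      case cameron
      then have "refines (V \<times> V) \<X> (cameron_scheme m k d)"
        unfolding cameron_scheme_def by (rule refines_cameron)
      moreover have "refines (V \<times> V) (tensor_power ?I \<Omega> (johnson_scheme m k)) \<X>"
        using fus unfolding fusion_def by (rule conjunct2)
      ultimately show ?thesis by (intro disjI1 conjI)
    next
      case (hamming e P)
      then have P: "partition_on ?I P" "\<forall>B\<in>P. card B = e" unfolding hamming_type_def by simp_all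
      have "d = e * card P" using card_blocks[OF I(1) P] by simp
      then have "e dvd d" "card P = d div e" using hamming(1) by simp_all
      then show ?thesis
        using hamming(1) P refines_blocks[OF hamming(2)]
        by (intro disjI2 exI[of _ e] exI[of _ P] conjI)
    qed
  qed
qed

end
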